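(* Let $\omega$ be a non-quasianalytic weight function satisfying $\log(1+t)=o(\omega(t))$ as $t\to\infty$. Then the convolution operator $C\colon\mathcal{O}'_{C,\omega}(\mathbb{R}^N)\times\mathcal{S}'_\omega(\mathbb{R}^N)\to\mathcal{S}'_\omega(\mathbb{R}^N)$, $(T,S)\mapsto T\star S$, is discontinuous (i.e. not jointly continuous for the product topology).
   Context: Weights. A non-quasianalytic weight function is a continuous increasing function $\omega:[0,\infty)\to[0,\infty)$ such that: ($\alpha$) there is $K\ge 1$ with $\omega(2t)\le K(1+\omega(t))$ for all $t\ge 0$; ($\beta$) $\int_1^\infty \frac{\omega(t)}{1+t^2}\,dt<\infty$; ($\gamma$) there are $a\in\mathbb{R}$, $b>0$ with $\omega(t)\ge a+b\log(1+t)$ for all $t\ge 0$; ($\delta$) $\varphi_\omega(t)=\omega(e^t)$ is convex. It is assumed (normalization) that $\omega$ vanishes on $[0,1]$. For $x\in\mathbb{R}^N$, $\omega(x):=\omega(|x|)$. The Young conjugate is $\varphi^*_\omega(s):=\sup_{t\ge 0}\{st-\varphi_\omega(t)\}$, $s\ge 0$ (the value $+\infty$ is allowed, with $\exp(-\infty)=0$). Spaces. $\mathcal{S}_\omega(\mathbb{R}^N)$ is the set of all $f\in L^1(\mathbb{R}^N)$ such that $f,\hat f\in C^\infty(\mathbb{R}^N)$ and $\|\exp(\lambda\omega)\partial^\alpha f\|_\infty<\infty$, $\|\exp(\lambda\omega)\partial^\alpha\hat f\|_\infty<\infty$ for all $\lambda>0$, $\alpha\in\mathbb{N}_0^N$;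 it is a Fréchet space with the norms $q_{m,n}(f):=\sup_{\alpha}\|\exp(n\omega)\partial^\alpha f\|_\infty\exp\left(-m\varphi^*_\omega\left(\frac{|\alpha|}{m}\right)\right)$, $m,n\in\mathbb{N}$. For $m,n\in\mathbb{N}$ let $\mathcal{O}^m_{n,\omega}(\mathbb{R}^N)$ be the space of all $f\in C^\infty(\mathbb{R}^N)$ with $r_{m,n}(f):=\sup_{\alpha\in\mathbb{N}_0^N}\sup_{x\in\mathbb{R}^N}|\partial^\alpha f(x)|\exp\left(-n\omega(x)-m\varphi^*_\omega\left(\frac{|\alpha|}{m}\right)\right)<\infty$, with norm $r_{m,n}$. Set $\mathcal{O}_{C,\omega}(\mathbb{R}^N):=\bigcup_{n}\bigcap_{m}\mathcal{O}^m_{n,\omega}(\mathbb{R}^N)$ with the topology of the locally convex inductive limit over $n$ of the projective limits $\mathrm{proj}_m\,\mathcal{O}^m_{n,\omega}(\mathbb{R}^N)$. A prime denotes the strong dual. The inclusion $\mathcal{S}_\omega(\mathbb{R}^N)\hookrightarrow\mathcal{O}_{C,\omega}(\mathbb{R}^N)$ is continuous with dense range. Convolution. For a functional $R$ and a function $f$, $(R\star f)(x):=\langle R_y,f(x-y)\rangle$. Put $\check f(x):=f(-x)$ and $\check T(f):=T(\check f)$. For $T\in\mathcal{O}'_{C,\omega}(\mathbb{R}^N)$ and $f\in\mathcal{S}_\omega(\mathbb{R}^N)$ it is known that $\check T\star f\in\mathcal{S}_\omega(\mathbb{R}^N)$, with $f\mapsto\check T\star f$ continuous on $\mathcal{S}_\omega(\mathbb{R}^N)$.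 For $T\in\mathcal{O}'_{C,\omega}(\mathbb{R}^N)$ and $S\in\mathcal{S}'_\omega(\mathbb{R}^N)$ the convolution $T\star S\in\mathcal{S}'_\omega(\mathbb{R}^N)$ is defined by $\langle T\star S,f\rangle:=\langle S,\check T\star f\rangle$, $f\in\mathcal{S}_\omega(\mathbb{R}^N)$. *)

theory Defs
  imports "HOL-Analysis.Analysis" "HOL-Library.Landau_Symbols"
begin

section \<open>Locally convex spaces of complex-valued functions\<close>

text \<open>
  A locally convex space is given by a topology whose \<open>topspace\<close> is a linear space of functions
  \<open>'x \<Rightarrow> complex\<close> with pointwise operations. The dual of a space of functions on \<open>'x\<close> is
  again of this kind, with \<open>'x \<Rightarrow> complex\<close> in the place of \<open>'x\<close>. Seminorms take values in
  \<open>ennreal\<close>, so that suprema need no side condition.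
\<close>

definition seminorm_topology ::
  "('x \<Rightarrow> complex) set \<Rightarrow> (('x \<Rightarrow> complex) \<Rightarrow> ennreal) set \<Rightarrow> ('x \<Rightarrow> complex) topology" where
  "seminorm_topology E P = topology_generated_by
     (insert E {{g \<in> E. p (\<lambda>x. g x - f x) < ennreal \<epsilon>} |p f \<epsilon>. p \<in> P \<and> f \<in> E \<and> \<epsilon> > 0})"

lemma topspace_seminorm_topology [simp]: "topspace (seminorm_topology E P) = E"
  unfolding seminorm_topology_def topology_generated_by_topspace by auto

definition seminorm_on :: "('x \<Rightarrow> complex) set \<Rightarrow> (('x \<Rightarrow> complex) \<Rightarrow> ennreal) \<Rightarrow> bool" where
  "seminorm_on E p \<longleftrightarrow>
     (\<forall>f\<in>E. p f < \<infinity>) \<and>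
     (\<forall>f\<in>E. \<forall>g\<in>E. p (\<lambda>x. f x + g x) \<le> p f + p g) \<and>
     (\<forall>f\<in>E. \<forall>c. p (\<lambda>x. c * f x) = ennreal (norm c) * p f)"

text \<open>
  The finest locally convex topology on the union making every inclusion continuous: it is
  generated by all seminorms whose restriction to each step is continuous.
\<close>

definition lc_inductive_limit ::
  "'i set \<Rightarrow> ('i \<Rightarrow> ('x \<Rightarrow> complex) topology) \<Rightarrow> ('x \<Rightarrow> complex) topology" where
  "lc_inductive_limit I X =
     (let E = (\<Union>i\<in>I. topspace (X i)) in
      seminorm_topology E
        {p. seminorm_on E p \<and> (\<forall>i\<in>I. continuous_map (X i) euclidean p)})"

definition tvs_bounded :: "('x \<Rightarrow> complex) topology \<Rightarrow> ('x \<Rightarrow> complex) set \<Rightarrow> bool" where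
  "tvs_bounded X B \<longleftrightarrow> B \<subseteq> topspace X \<and>
     (\<forall>U. openin X U \<and> (\<lambda>x. 0) \<in> U \<longrightarrow>
       (\<exists>c::real. c > 0 \<and> B \<subseteq> (\<lambda>f x. complex_of_real c * f x) ` U))"

text \<open>Functionals are taken to be \<open>undefined\<close> off the space, so that equality in the dual is
  equality on the space.\<close>

definition dual_space :: "('x \<Rightarrow> complex) topology \<Rightarrow> (('x \<Rightarrow> complex) \<Rightarrow> complex) set" where
  "dual_space X = {T \<in> extensional (topspace X).
     (\<forall>f\<in>topspace X. \<forall>g\<in>topspace X. T (\<lambda>x. f x + g x) = T f + T g) \<and>
     (\<forall>f\<in>topspace X. \<forall>c. T (\<lambda>x. c * f x) = c * T f) \<and>
     continuous_map X euclidean T}"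

definition strong_dual :: "('x \<Rightarrow> complex) topology \<Rightarrow> (('x \<Rightarrow> complex) \<Rightarrow> complex) topology" where
  "strong_dual X = seminorm_topology (dual_space X)
     {(\<lambda>T. SUP f\<in>B. ennreal (norm (T f))) |B. tvs_bounded X B}"


section \<open>Partial derivatives and the Fourier transform\<close>

definition partial :: "'n \<Rightarrow> (real^'n \<Rightarrow> complex) \<Rightarrow> (real^'n \<Rightarrow> complex)" where
  "partial i f = (\<lambda>x. vector_derivative (\<lambda>t. f (x + t *\<^sub>R axis i 1)) (at 0))"

text \<open>\<open>C\<^sup>\<infinity>\<close>: all iterated partial derivatives, in any order, exist and are continuous.\<close>

definition smooth :: "(real^'n \<Rightarrow> complex) \<Rightarrow> bool" where
  "smooth f \<longleftrightarrow> (\<forall>is. let g = foldr partial is f in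
     continuous_on UNIV g \<and>
     (\<forall>i x. (\<lambda>t::real. g (x + t *\<^sub>R axis i 1)) differentiable (at 0)))"

text \<open>For \<open>\<alpha> :: 'n \<Rightarrow> nat\<close>, \<open>\<partial>\<^sup>\<alpha>\<close> applies the coordinate derivatives along some enumeration
  of the finite index type; on smooth functions the choice does not matter.\<close>

definition mpartial :: "('n::finite \<Rightarrow> nat) \<Rightarrow> (real^'n \<Rightarrow> complex) \<Rightarrow> (real^'n \<Rightarrow> complex)" where
  "mpartial \<alpha> f = foldr (\<lambda>i. partial i ^^ \<alpha> i) (SOME is. set is = UNIV \<and> distinct is) f"

definition morder :: "('n::finite \<Rightarrow> nat) \<Rightarrow> nat" where
  "morder \<alpha> = (\<Sum>i\<in>UNIV. \<alpha> i)"

definition fourier :: "(real^'n \<Rightarrow> complex) \<Rightarrow> (real^'n \<Rightarrow> complex)" where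
  "fourier f = (\<lambda>\<xi>. \<integral>x. cis (- (x \<bullet> \<xi>)) * f x \<partial>lborel)"


section \<open>Weight functions\<close>

text \<open>A weight is a function on \<open>[0,\<infinity>)\<close>; its values at negative arguments are irrelevant.
  The last condition is the normalization.\<close>

definition nonquasianalytic_weight :: "(real \<Rightarrow> real) \<Rightarrow> bool" where
  "nonquasianalytic_weight \<omega> \<longleftrightarrow>
     continuous_on {0..} \<omega> \<and> mono_on {0..} \<omega> \<and> (\<forall>t\<ge>0. \<omega> t \<ge> 0) \<and>
     (\<exists>K\<ge>1. \<forall>t\<ge>0. \<omega> (2 * t) \<le> K * (1 + \<omega> t)) \<and>
     set_integrable lborel {1..} (\<lambda>t. \<omega> t / (1 + t\<^sup>2)) \<and>
     (\<exists>a b. b > 0 \<and> (\<forall>t\<ge>0. \<omega> t \<ge> a + b * ln (1 + t))) \<and>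
     convex_on UNIV (\<lambda>t. \<omega> (exp t)) \<and>
     (\<forall>t\<in>{0..1}. \<omega> t = 0)"

definition young_conj :: "(real \<Rightarrow> real) \<Rightarrow> real \<Rightarrow> ereal" where
  "young_conj \<omega> s = (SUP t\<in>{0..}. ereal (s * t - \<omega> (exp t)))"

text \<open>\<open>exp (- m \<phi>\<^sup>*(k / m))\<close> with \<open>exp (-\<infinity>) = 0\<close>; for a normalized weight the conjugate is
  nonnegative, so \<open>-\<infinity>\<close> does not occur as its value.\<close>

definition young_factor :: "(real \<Rightarrow> real) \<Rightarrow> nat \<Rightarrow> nat \<Rightarrow> real" where
  "young_factor \<omega> m k =
     (let s = young_conj \<omega> (real k / real m) in
      if s = \<infinity> then 0 else exp (- (real m * real_of_ereal s)))"


section \<open>The space \<open>S\<^sub>\<omega>\<close>\<close>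

definition S_set :: "(real \<Rightarrow> real) \<Rightarrow> (real^'n \<Rightarrow> complex) set" where
  "S_set \<omega> = {f. integrable lborel f \<and> smooth f \<and> smooth (fourier f) \<and>
     (\<forall>l>0. \<forall>\<alpha>.
        bounded (range (\<lambda>x. exp (l * \<omega> (norm x)) *\<^sub>R mpartial \<alpha> f x)) \<and>
        bounded (range (\<lambda>x. exp (l * \<omega> (norm x)) *\<^sub>R mpartial \<alpha> (fourier f) x)))}"

definition S_norm :: "(real \<Rightarrow> real) \<Rightarrow> nat \<Rightarrow> nat \<Rightarrow> (real^'n \<Rightarrow> complex) \<Rightarrow> ennreal" where
  "S_norm \<omega> m n f =
     (SUP \<alpha>. (SUP x. ennreal (exp (real n * \<omega> (norm x)) * norm (mpartial \<alpha> f x)))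
        * ennreal (young_factor \<omega> m (morder \<alpha>)))"

definition S_space :: "(real \<Rightarrow> real) \<Rightarrow> (real^'n \<Rightarrow> complex) topology" where
  "S_space \<omega> = seminorm_topology (S_set \<omega>) {S_norm \<omega> m n |m n. m \<ge> 1 \<and> n \<ge> 1}"


section \<open>The space \<open>O\<^sub>C\<^sub>,\<^sub>\<omega>\<close>\<close>

definition O_norm :: "(real \<Rightarrow> real) \<Rightarrow> nat \<Rightarrow> nat \<Rightarrow> (real^'n \<Rightarrow> complex) \<Rightarrow> ennreal" where
  "O_norm \<omega> m n f =
     (SUP \<alpha>. SUP x. ennreal (norm (mpartial \<alpha> f x) * exp (- (real n * \<omega> (norm x)))
        * young_factor \<omega> m (morder \<alpha>)))"

definition O_set :: "(real \<Rightarrow> real) \<Rightarrow> nat \<Rightarrow> nat \<Rightarrow> (real^'n \<Rightarrow> complex) set" where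
  "O_set \<omega> m n = {f. smooth f \<and> O_norm \<omega> m n f < \<infinity>}"

definition OC_step :: "(real \<Rightarrow> real) \<Rightarrow> nat \<Rightarrow> (real^'n \<Rightarrow> complex) topology" where
  "OC_step \<omega> n = seminorm_topology (\<Inter>m\<in>{1..}. O_set \<omega> m n) {O_norm \<omega> m n |m. m \<ge> 1}"

definition OC_space :: "(real \<Rightarrow> real) \<Rightarrow> (real^'n \<Rightarrow> complex) topology" where
  "OC_space \<omega> = lc_inductive_limit {1..} (OC_step \<omega>)"

lemma topspace_OC_space: "topspace (OC_space \<omega>) = (\<Union>n\<in>{1..}. \<Inter>m\<in>{1..}. O_set \<omega> m n)"
  by (simp add: OC_space_def lc_inductive_limit_def OC_step_def Let_def)


section \<open>Convolution\<close>

definition reflect :: "(real^'n \<Rightarrow> complex) \<Rightarrow> (real^'n \<Rightarrow> complex)" where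
  "reflect f = (\<lambda>x. f (- x))"

definition reflect_functional ::
  "((real^'n \<Rightarrow> complex) \<Rightarrow> complex) \<Rightarrow> ((real^'n \<Rightarrow> complex) \<Rightarrow> complex)" where
  "reflect_functional T = (\<lambda>f. T (reflect f))"

definition conv_fun ::
  "((real^'n \<Rightarrow> complex) \<Rightarrow> complex) \<Rightarrow> (real^'n \<Rightarrow> complex) \<Rightarrow> (real^'n \<Rightarrow> complex)" where
  "conv_fun R f = (\<lambda>x. R (\<lambda>y. f (x - y)))"

definition convolution :: "(real \<Rightarrow> real) \<Rightarrow> ((real^'n \<Rightarrow> complex) \<Rightarrow> complex)
    \<Rightarrow> ((real^'n \<Rightarrow> complex) \<Rightarrow> complex) \<Rightarrow> ((real^'n \<Rightarrow> complex) \<Rightarrow> complex)" where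
  "convolution \<omega> T S = (\<lambda>f\<in>S_set \<omega>. S (conv_fun (reflect_functional T) f))"

end

theory Submission
  imports "HOL-Complex_Analysis.Cauchy_Integral_Formula" "HOL-Probability.Characteristic_Functions"
    "HOL-Real_Asymp.Real_Asymp" Defs
begin

text \<open>
  Suppose that the convolution is continuous at the origin, and test its values on a Gaussian \<open>f\<close>.
  A neighbourhood of the origin in a strong dual is controlled by finitely many bounded sets. A bounded
  subset of \<open>O\<^sub>C\<^sub>,\<^sub>\<omega>\<close> obeys a single bound \<open>\<bar>g x\<bar> \<le> C exp (n \<omega> x)\<close>: otherwise some
  \<open>\<bar>g\<^sub>k z\<^sub>k\<bar> > k exp (k \<omega> z\<^sub>k)\<close>, and the seminorm \<open>sup\<^sub>k \<bar>g z\<^sub>k\<bar> exp (- k \<omega> z\<^sub>k)\<close>, which is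
  continuous on the inductive limit, is unbounded on the set. A bounded subset of \<open>S\<^sub>\<omega>\<close> obeys
  \<open>\<bar>g x\<bar> \<le> D exp (- (n + 1) \<omega> x)\<close>. So for fixed \<open>s, t > 0\<close> and every point \<open>z\<close> the functionals
  \<open>t exp (- n \<omega> z) \<delta>\<^sub>z\<close> and \<open>s exp ((n + 1) \<omega> z) \<delta>\<^sub>-\<^sub>z\<close> lie in the given neighbourhoods, whereas
  their convolution maps \<open>f\<close> to \<open>s t exp (\<omega> z) f 0\<close>, which is unbounded in \<open>z\<close>.

  That the Gaussian has finite norms rests on \<open>\<omega> t = o(t)\<close>, a consequence of the integrability condition,
  and on Cauchy's estimates for its derivatives.
\<close>

text \<open>The import of \<open>Defs\<close> comes last so that \<open>convolution\<close> is not the convolution of measures.\<close>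

section \<open>Topologies generated by seminorms\<close>

lemma openin_seminorm_topology:
  assumes "p \<in> P" "f \<in> E" "\<epsilon> > 0"
  shows "openin (seminorm_topology E P) {g \<in> E. p (\<lambda>x. g x - f x) < ennreal \<epsilon>}"
  unfolding seminorm_topology_def
  by (rule topology_generated_by_Basis) (use assms in blast)

text \<open>The element \<open>z\<close> plays the role of the origin. It is kept abstract because the zero of a dual
  space is not the constant function \<open>0\<close> but its restriction to the space.\<close>

lemma seminorm_topology_nhd:
  assumes "openin (seminorm_topology E P) U" "z \<in> U"
    and tri: "\<And>p g h. p \<in> P \<Longrightarrow> g \<in> E \<Longrightarrow> h \<in> E \<Longrightarrow>
      p (\<lambda>x. g x - h x) \<le> p g + p (\<lambda>x. z x - h x)"
  obtains Q \<delta> where "finite Q" "Q \<subseteq> P" "\<delta> > 0"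
    "\<And>g. g \<in> E \<Longrightarrow> (\<And>p. p \<in> Q \<Longrightarrow> p g < ennreal \<delta>) \<Longrightarrow> g \<in> U"
proof -
  \<comment> \<open>The conclusion is stated as a property of the set alone, so that
    \<open>z \<in> U \<longrightarrow> good U\<close> can be carried through the inductive
    generation of the topology.\<close>
  define good where "good U \<longleftrightarrow> (\<exists>Q \<delta>. finite Q \<and> Q \<subseteq> P \<and> \<delta> > 0 \<and>
    (\<forall>g\<in>E. (\<forall>p\<in>Q. p g < ennreal \<delta>) \<longrightarrow> g \<in> U))" for U
  have "generate_topology_on
      (insert E {{g \<in> E. p (\<lambda>x. g x - f x) < ennreal \<epsilon>} |p f \<epsilon>. p \<in> P \<and> f \<in> E \<and> \<epsilon> > 0}) U"
    using assms(1) unfolding seminorm_topology_def openin_topology_generated_by_iff .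
  then have "z \<in> U \<longrightarrow> good U"
  proof induction
    case Empty
    then show ?case by simp
  next
    case (Int a b)
    show ?case
    proof
      assume "z \<in> a \<inter> b"
      then have "good a" "good b" using Int by auto
      then obtain Q \<delta> Q' \<delta>' where *: "finite Q" "Q \<subseteq> P" "\<delta> > 0" "finite Q'" "Q' \<subseteq> P" "\<delta>' > 0"
        "\<forall>g\<in>E. (\<forall>p\<in>Q. p g < ennreal \<delta>) \<longrightarrow> g \<in> a" "\<forall>g\<in>E. (\<forall>p\<in>Q'. p g < ennreal \<delta>') \<longrightarrow> g \<in> b"
        unfolding good_def by blast
      have "g \<in> a \<inter> b" if "g \<in> E" "\<forall>p\<in>Q \<union> Q'. p g < ennreal (min \<delta> \<delta>')" for g
      proof -
        have "p g < ennreal \<delta> \<and> p g < ennreal \<delta>'" if "p \<in> Q \<union> Q'" for p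
        proof -
          have "p g < ennreal (min \<delta> \<delta>')"
            using \<open>\<forall>p\<in>Q \<union> Q'. p g < ennreal (min \<delta> \<delta>')\<close> that by blast
          moreover have "ennreal (min \<delta> \<delta>') \<le> ennreal \<delta>" "ennreal (min \<delta> \<delta>') \<le> ennreal \<delta>'"
            by (simp_all add: ennreal_leI)
          ultimately show ?thesis by (auto intro: less_le_trans)
        qed
        then show ?thesis using * \<open>g \<in> E\<close> by auto
      qed
      then show "good (a \<inter> b)"
        unfolding good_def using * by (intro exI[of _ "Q \<union> Q'"] exI[of _ "min \<delta> \<delta>'"]) auto
    qed
  next
    case (UN K)
    show ?case
    proof
      assume "z \<in> \<Union>K"
      then obtain k where "k \<in> K" "good k" using UN by blast
      then show "good (\<Union>K)" unfolding good_def by blast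
    qed
  next
    case (Basis s)
    show ?case
    proof
      assume z: "z \<in> s"
      from Basis consider "s = E"
        | p h \<epsilon> where "s = {g \<in> E. p (\<lambda>x. g x - h x) < ennreal \<epsilon>}" "p \<in> P" "h \<in> E" "\<epsilon> > 0" by auto
      then show "good s"
      proof cases
        case 1
        then show ?thesis unfolding good_def by (intro exI[of _ "{}"] exI[of _ 1]) auto
      next
        case (2 p h \<epsilon>)
        then obtain r where r: "p (\<lambda>x. z x - h x) = ennreal r" "0 \<le> r" "r < \<epsilon>"
          using z by (cases "p (\<lambda>x. z x - h x)") (auto simp: ennreal_less_iff)
        \<comment> \<open>A basic ball is centred at some \<open>h\<close> rather than at
          \<open>z\<close>. Since \<open>z\<close> lies at distance \<open>r\<close> from
          \<open>h\<close>, the slack \<open>\<epsilon> - r\<close> is the radius left for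
          \<open>p g\<close>.\<close>
        have "g \<in> s" if g: "g \<in> E" "p g < ennreal (\<epsilon> - r)" for g
        proof -
          obtain q where q: "p g = ennreal q" "0 \<le> q" "q < \<epsilon> - r"
            using g(2) by (cases "p g") (auto simp: ennreal_less_iff)
          have "p (\<lambda>x. g x - h x) \<le> ennreal (q + r)"
            using tri[OF \<open>p \<in> P\<close> \<open>g \<in> E\<close> \<open>h \<in> E\<close>] q r by simp
          also have "\<dots> < ennreal \<epsilon>" using q r by (intro ennreal_lessI) auto
          finally show ?thesis using 2 g by simp
        qed
        then show ?thesis unfolding good_def
          using 2 r by (intro exI[of _ "{p}"] exI[of _ "\<epsilon> - r"]) auto
      qed
    qed
  qed
  then obtain Q \<delta> where "finite Q" "Q \<subseteq> P" "\<delta> > 0" "\<forall>g\<in>E. (\<forall>p\<in>Q. p g < ennreal \<delta>) \<longrightarrow> g \<in> U"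
    using assms(2) unfolding good_def by blast
  then show ?thesis by (intro that[of Q \<delta>]) auto
qed

text \<open>A Lipschitz bound by one generating seminorm suffices, because the balls of
  \<open>q\<close> around every point are open.\<close>

lemma continuous_map_seminorm_topology:
  fixes F :: "('x \<Rightarrow> complex) \<Rightarrow> 'b::metric_space"
  assumes "q \<in> P" "C \<ge> 0" and q0: "q (\<lambda>x. 0) = 0"
    and F: "\<And>f g. f \<in> E \<Longrightarrow> g \<in> E \<Longrightarrow> ennreal (dist (F g) (F f)) \<le> ennreal C * q (\<lambda>x. g x - f x)"
  shows "continuous_map (seminorm_topology E P) euclidean F"
  unfolding continuous_map_def
proof (intro conjI allI impI)
  fix U :: "'b set" assume "openin euclidean U"
  then have U: "open U" by simp
  show "openin (seminorm_topology E P) {x \<in> topspace (seminorm_topology E P). F x \<in> U}"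
  proof (subst openin_subopen, intro ballI)
    fix f assume "f \<in> {x \<in> topspace (seminorm_topology E P). F x \<in> U}"
    then have f: "f \<in> E" "F f \<in> U" by auto
    obtain e where e: "e > 0" "\<And>y. dist y (F f) < e \<Longrightarrow> y \<in> U"
      using U f(2) unfolding open_dist by blast
    \<comment> \<open>Dividing by \<open>C + 1\<close> instead of \<open>C\<close> covers
      \<open>C = 0\<close>.\<close>
    define V where "V = {g \<in> E. q (\<lambda>x. g x - f x) < ennreal (e / (C + 1))}"
    have "openin (seminorm_topology E P) V"
      unfolding V_def using assms e f by (intro openin_seminorm_topology) auto
    moreover have "f \<in> V" unfolding V_def using f e q0 \<open>C \<ge> 0\<close> by simp
    moreover have "F g \<in> U" if gV: "g \<in> V" for g
    proof -
      obtain r where r: "q (\<lambda>x. g x - f x) = ennreal r" "0 \<le> r" "r < e / (C + 1)"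
        using gV e \<open>C \<ge> 0\<close> unfolding V_def
        by (cases "q (\<lambda>x. g x - f x)") (auto simp: ennreal_less_iff)
      have "ennreal (dist (F g) (F f)) \<le> ennreal (C * r)"
        using F[OF f(1), of g] that r \<open>C \<ge> 0\<close> unfolding V_def by (simp add: ennreal_mult)
      then have "dist (F g) (F f) \<le> C * r" using r \<open>C \<ge> 0\<close> by (subst (asm) ennreal_le_iff) auto
      also have "\<dots> \<le> (C + 1) * r" using r by (simp add: algebra_simps)
      also have "\<dots> < e" using r(3) \<open>C \<ge> 0\<close> by (simp add: field_simps)
      finally show ?thesis by (rule e(2))
    qed
    ultimately show "\<exists>T. openin (seminorm_topology E P) T \<and> f \<in> T \<and>
        T \<subseteq> {x \<in> topspace (seminorm_topology E P). F x \<in> U}"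
      by (intro exI[of _ V]) (auto simp: V_def)
  qed
qed auto

text \<open>The reverse triangle inequality makes \<open>p\<close> Lipschitz with respect to
  \<open>q\<close>. To have a metric on the target, the argument runs on
  \<open>enn2real (p f)\<close> and returns through the continuous map
  \<open>ennreal\<close>.\<close>

lemma continuous_map_seminorm:
  fixes p :: "('x \<Rightarrow> complex) \<Rightarrow> ennreal"
  assumes "q \<in> P" "C \<ge> 0" "q (\<lambda>x. 0) = 0"
    and fin: "\<And>f. f \<in> E \<Longrightarrow> p f < \<infinity>"
    and tri: "\<And>f g. p (\<lambda>x. f x + g x) \<le> p f + p g"
    and sym: "\<And>f g. p (\<lambda>x. f x - g x) = p (\<lambda>x. g x - f x)"
    and bound: "\<And>f g. f \<in> E \<Longrightarrow> g \<in> E \<Longrightarrow> p (\<lambda>x. g x - f x) \<le> ennreal C * q (\<lambda>x. g x - f x)"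
  shows "continuous_map (seminorm_topology E P) euclidean p"
proof -
  have "ennreal (dist (enn2real (p g)) (enn2real (p f))) \<le> p (\<lambda>x. g x - f x)"
    if fg: "f \<in> E" "g \<in> E" for f g
  proof (cases "p (\<lambda>x. g x - f x)")
    case (real r)
    obtain a b where ab: "p f = ennreal a" "p g = ennreal b" "0 \<le> a" "0 \<le> b"
      using fin[OF fg(1)] fin[OF fg(2)] by (cases "p f"; cases "p g") auto
    have "p g \<le> p f + p (\<lambda>x. g x - f x)" using tri[of f "\<lambda>x. g x - f x"] by simp
    then have "b \<le> a + r" using ab real by (simp flip: ennreal_plus)
    moreover have "p f \<le> p g + p (\<lambda>x. g x - f x)" using tri[of g "\<lambda>x. f x - g x"] sym[of f g] by simp
    then have "a \<le> b + r" using ab real by (simp flip: ennreal_plus)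
    ultimately show ?thesis using ab real by (auto simp: dist_real_def)
  qed simp
  then have "continuous_map (seminorm_topology E P) euclidean (\<lambda>f. enn2real (p f))"
    using bound by (intro continuous_map_seminorm_topology[OF assms(1-3)]) (blast intro: order_trans)
  then have "continuous_map (seminorm_topology E P) euclidean (ennreal \<circ> (\<lambda>f. enn2real (p f)))"
    by (rule continuous_map_compose) (simp add: continuous_on_ennreal)
  then show ?thesis
    by (rule continuous_map_eq) (use fin in \<open>auto simp: less_top\<close>)
qed

section \<open>Neighbourhoods in strong duals and absorption of bounded sets\<close>

lemma topspace_strong_dual [simp]: "topspace (strong_dual X) = dual_space X"
  by (simp add: strong_dual_def)

text \<open>Turns a strong neighbourhood of zero into uniform smallness on finitely many bounded
  sets. The zero \<open>z\<close> is only required to vanish on the space, since functionals are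
  \<open>undefined\<close> off it.\<close>

lemma strong_dual_nhd:
  assumes "openin (strong_dual X) U" "z \<in> U" "\<And>f. f \<in> topspace X \<Longrightarrow> z f = 0"
  obtains \<B> \<delta> where "finite \<B>" "\<And>B. B \<in> \<B> \<Longrightarrow> tvs_bounded X B" "\<delta> > 0"
    "\<And>T. T \<in> dual_space X \<Longrightarrow> (\<And>B f. B \<in> \<B> \<Longrightarrow> f \<in> B \<Longrightarrow> norm (T f) < \<delta>) \<Longrightarrow> T \<in> U"
proof -
  let ?p = "\<lambda>B T. SUP f\<in>B. ennreal (norm (T f))"
  have tri: "p (\<lambda>x. g x - h x) \<le> p g + p (\<lambda>x. z x - h x)"
    if p: "p \<in> {?p B |B. tvs_bounded X B}" for p g h
  proof -
    obtain B where B: "tvs_bounded X B" "p = ?p B" using p by auto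
    have "ennreal (norm (g f - h f)) \<le> p g + p (\<lambda>x. z x - h x)" if f: "f \<in> B" for f
    proof -
      have "f \<in> topspace X" using B f unfolding tvs_bounded_def by blast
      then have "norm (g f - h f) \<le> norm (g f) + norm (z f - h f)"
        using assms(3) norm_triangle_ineq4[of "g f" "h f"] by simp
      then have "ennreal (norm (g f - h f)) \<le> ennreal (norm (g f)) + ennreal (norm (z f - h f))"
        by (simp flip: ennreal_plus)
      also have "\<dots> \<le> p g + p (\<lambda>x. z x - h x)"
        unfolding B using f by (intro add_mono SUP_upper)
      finally show ?thesis .
    qed
    then show ?thesis unfolding B(2) by (intro SUP_least)
  qed
  obtain Q \<delta> where Q: "finite Q" "Q \<subseteq> {?p B |B. tvs_bounded X B}" "\<delta> > 0"
    "\<And>g. g \<in> dual_space X \<Longrightarrow> (\<And>p. p \<in> Q \<Longrightarrow> p g < ennreal \<delta>) \<Longrightarrow> g \<in> U"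
    by (rule seminorm_topology_nhd[OF assms(1)[unfolded strong_dual_def] assms(2)]) (rule tri, assumption, blast)
  have "Q \<subseteq> ?p ` {B. tvs_bounded X B}" using Q(2) by auto
  then obtain \<B> where \<B>: "finite \<B>" "\<B> \<subseteq> {B. tvs_bounded X B}" "Q = ?p ` \<B>"
    using finite_subset_image[OF Q(1), of ?p] by metis
  show ?thesis
  proof
    \<comment> \<open>Halving compensates for the supremum: values below \<open>\<delta> / 2\<close>
      have a supremum at most \<open>\<delta> / 2\<close>, which is strictly below
      \<open>\<delta>\<close>.\<close>
    show "finite \<B>" "\<And>B. B \<in> \<B> \<Longrightarrow> tvs_bounded X B" "\<delta> / 2 > 0" using \<B> Q(3) by auto
    fix T assume T: "T \<in> dual_space X" "\<And>B f. B \<in> \<B> \<Longrightarrow> f \<in> B \<Longrightarrow> norm (T f) < \<delta> / 2"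
    have "?p B T < ennreal \<delta>" if "B \<in> \<B>" for B
    proof -
      have "?p B T \<le> ennreal (\<delta> / 2)"
        using T(2)[OF that] by (intro SUP_least ennreal_leI less_imp_le)
      also have "\<dots> < ennreal \<delta>" using Q(3) by (intro ennreal_lessI) auto
      finally show ?thesis .
    qed
    then show "T \<in> U" using Q(4)[OF T(1)] \<B>(3) by blast
  qed
qed

text \<open>A ball of the seminorm given by the bounded set \<open>{f}\<close>; centring it at a
  functional with \<open>z f = 0\<close> removes the subtraction.\<close>

lemma openin_strong_dual_singleton:
  assumes "tvs_bounded X {f}" "z \<in> dual_space X" "z f = 0"
  shows "openin (strong_dual X) {T \<in> dual_space X. norm (T f) < 1}"
proof -
  have "openin (strong_dual X)
    {T \<in> dual_space X. (SUP f\<in>{f}. ennreal (norm (T f - z f))) < ennreal 1}"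
    unfolding strong_dual_def
    by (rule openin_seminorm_topology[where p = "\<lambda>T. SUP f\<in>{f}. ennreal (norm (T f))"])
       (use assms in \<open>blast | simp\<close>)+
  then show ?thesis using assms(3) by (simp add: ennreal_less_iff flip: ennreal_1)
qed

text \<open>The open unit ball of \<open>p\<close> is a neighbourhood of the origin, so some
  multiple of it absorbs \<open>B\<close>.\<close>

lemma tvs_bounded_seminorm:
  assumes B: "tvs_bounded (seminorm_topology E P) B" and "p \<in> P" "(\<lambda>x. 0) \<in> E" "p (\<lambda>x. 0) = 0"
  obtains C where "C > 0"
    "\<And>g. g \<in> B \<Longrightarrow> \<exists>u. p u < 1 \<and> g = (\<lambda>x. complex_of_real C * u x)"
proof -
  let ?U = "{g \<in> E. p (\<lambda>x. g x - 0) < ennreal 1}"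
  have "openin (seminorm_topology E P) ?U" "(\<lambda>x. 0) \<in> ?U"
    using assms openin_seminorm_topology[of p P "\<lambda>x. 0" E 1] by auto
  then obtain c where "c > 0" "B \<subseteq> (\<lambda>f x. complex_of_real c * f x) ` ?U"
    using B unfolding tvs_bounded_def by blast
  then show ?thesis by (intro that[of c]) auto
qed

section \<open>Iterated partial derivatives\<close>

text \<open>\<open>smooth\<close> speaks of arbitrary lists of partial derivatives. Flattening the
  powers into one list makes facts about such lists available for multi-indices.\<close>

lemma mpartial_eq_foldr:
  fixes \<alpha> :: "'n::finite \<Rightarrow> nat"
  shows "\<exists>is. \<forall>f. mpartial \<alpha> f = foldr partial is f"
proof -
  have "foldr (\<lambda>i. partial i ^^ \<alpha> i) xs f = foldr partial (concat (map (\<lambda>i. replicate (\<alpha> i) i) xs)) f"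
    for xs and f :: "real^'n \<Rightarrow> complex"
    by (induction xs) (simp_all add: foldr_replicate)
  then show ?thesis unfolding mpartial_def by metis
qed

lemma mpartial_0 [simp]: "mpartial (\<lambda>_. 0) f = f"
proof -
  have "foldr (\<lambda>i. partial i ^^ 0) xs f = f" for xs by (induction xs) simp_all
  then show ?thesis unfolding mpartial_def by simp
qed

lemma morder_0 [simp]: "morder (\<lambda>_. 0) = 0"
  by (simp add: morder_def)

lemma partial_lincomb:
  assumes "(\<lambda>t::real. f (x + t *\<^sub>R axis i 1)) differentiable (at 0)"
    and "(\<lambda>t::real. g (x + t *\<^sub>R axis i 1)) differentiable (at 0)"
  shows "partial i (\<lambda>x. a * f x + b * g x) x = a * partial i f x + b * partial i g x"
  using assms unfolding partial_def vector_derivative_works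
  by (intro vector_derivative_at has_vector_derivative_add has_vector_derivative_mult_right)

lemma foldr_partial_lincomb:
  assumes "smooth f" "smooth g"
  shows "foldr partial is (\<lambda>x. a * f x + b * g x) =
    (\<lambda>x. a * foldr partial is f x + b * foldr partial is g x)"
proof (induction "is")
  case (Cons i "is")
  have "partial i (\<lambda>x. a * foldr partial is f x + b * foldr partial is g x) x =
      a * partial i (foldr partial is f) x + b * partial i (foldr partial is g) x" for x
    using assms unfolding smooth_def Let_def by (intro partial_lincomb) auto
  then show ?case by (simp add: Cons)
qed simp

lemma smooth_lincomb:
  assumes "smooth f" "smooth g"
  shows "smooth (\<lambda>x. a * f x + b * g x)"
  using assms unfolding smooth_def foldr_partial_lincomb[OF assms] Let_def
  by (auto intro!: continuous_intros derivative_intros differentiable_mult)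

lemma mpartial_lincomb:
  assumes "smooth f" "smooth g"
  shows "mpartial \<alpha> (\<lambda>x. a * f x + b * g x) = (\<lambda>x. a * mpartial \<alpha> f x + b * mpartial \<alpha> g x)"
  using mpartial_eq_foldr[of \<alpha>] foldr_partial_lincomb[OF assms] by metis

lemma partial_0: "partial i (\<lambda>x. 0) = (\<lambda>x. 0)"
  by (simp add: partial_def)

lemma foldr_partial_0: "foldr partial is (\<lambda>x. 0) = (\<lambda>x. 0)"
  by (induction "is") (simp_all add: partial_0)

lemma smooth_0 [simp]: "smooth (\<lambda>x. 0)"
  by (simp add: smooth_def foldr_partial_0)

lemma mpartial_zero_fun [simp]: "mpartial \<alpha> (\<lambda>x. 0) = (\<lambda>x. 0)"
  using mpartial_eq_foldr[of \<alpha>] foldr_partial_0 by metis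

section \<open>Tensor products of entire functions\<close>

text \<open>Products of one-variable functions, evaluated at real coordinates. For entire factors
  the class is closed under partial derivatives, which become complex derivatives of single factors
  and so come within reach of Cauchy's inequality.\<close>

definition tensor :: "('n::finite \<Rightarrow> complex \<Rightarrow> complex) \<Rightarrow> real^'n \<Rightarrow> complex" where
  "tensor F x = (\<Prod>j\<in>UNIV. F j (complex_of_real (x $ j)))"

text \<open>Only the factor at \<open>i\<close> varies along \<open>axis i 1\<close>, so the complex
  derivative of one entire function, restricted to the real line, gives the result.\<close>

lemma tensor_has_vector_derivative:
  fixes F :: "'n::finite \<Rightarrow> complex \<Rightarrow> complex"
  assumes "F i holomorphic_on UNIV"
  shows "((\<lambda>t. tensor F (x + t *\<^sub>R axis i 1)) has_vector_derivative tensor (F(i := deriv (F i))) x) (at 0)"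
proof -
  let ?P = "\<Prod>j\<in>UNIV - {i}. F j (complex_of_real (x $ j))"
  have eq: "tensor F (x + t *\<^sub>R axis i 1) = F i (of_real (x $ i) + of_real t) * ?P" for t
  proof -
    have "tensor F (x + t *\<^sub>R axis i 1) = F i (of_real (x $ i) + of_real t) *
        (\<Prod>j\<in>UNIV - {i}. F j (complex_of_real ((x + t *\<^sub>R axis i 1) $ j)))"
      unfolding tensor_def by (subst prod.remove[of _ i]) (auto simp: axis_def)
    also have "(\<Prod>j\<in>UNIV - {i}. F j (complex_of_real ((x + t *\<^sub>R axis i 1) $ j))) = ?P"
      by (intro prod.cong) (auto simp: axis_def)
    finally show ?thesis .
  qed
  have eq': "tensor (F(i := deriv (F i))) x = deriv (F i) (of_real (x $ i)) * ?P"
    unfolding tensor_def by (subst prod.remove[of _ i]) (auto intro!: prod.cong)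
  have "((\<lambda>u. F i (of_real (x $ i) + u)) has_field_derivative deriv (F i) (of_real (x $ i))) (at (of_real 0))"
  proof -
    have "(F i has_field_derivative deriv (F i) (of_real (x $ i))) (at (0 + of_real (x $ i)))"
      using holomorphic_derivI[OF assms open_UNIV] by simp
    then show ?thesis by (subst (asm) DERIV_shift) (simp add: add.commute)
  qed
  then have "((\<lambda>t. F i (of_real (x $ i) + of_real t)) has_vector_derivative deriv (F i) (of_real (x $ i))) (at 0)"
    by (rule has_vector_derivative_real_field)
  then show ?thesis unfolding eq eq' by (rule has_vector_derivative_mult_left)
qed

lemma partial_tensor:
  assumes "F i holomorphic_on UNIV"
  shows "partial i (tensor F) = tensor (F(i := deriv (F i)))"
  unfolding partial_def using vector_derivative_at[OF tensor_has_vector_derivative[of F i, OF assms]] by blast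

lemma continuous_on_tensor:
  assumes "\<And>j. F j holomorphic_on UNIV"
  shows "continuous_on UNIV (tensor F)"
  unfolding tensor_def
  by (intro continuous_on_prod continuous_on_compose2[OF holomorphic_on_imp_continuous_on[OF assms]]
      continuous_intros) auto

lemma smooth_tensor:
  assumes "\<And>j. F j holomorphic_on UNIV"
  shows "smooth (tensor F)"
proof -
  have *: "\<exists>G. foldr partial is (tensor F) = tensor G \<and> (\<forall>j. G j holomorphic_on UNIV)" for "is"
  proof (induction "is")
    case (Cons i "is")
    then obtain G where "foldr partial is (tensor F) = tensor G" "\<forall>j. G j holomorphic_on UNIV" by blast
    then show ?case
      by (intro exI[of _ "G(i := deriv (G i))"]) (auto simp: partial_tensor holomorphic_deriv simp flip: fun_upd_def)
  qed (use assms in auto)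
  show ?thesis unfolding smooth_def Let_def
  proof (intro allI)
    fix "is" show "continuous_on UNIV (foldr partial is (tensor F)) \<and>
      (\<forall>i x. (\<lambda>t::real. foldr partial is (tensor F) (x + t *\<^sub>R axis i 1)) differentiable (at 0))"
      using *[of "is"] continuous_on_tensor tensor_has_vector_derivative
      by (metis differentiableI_vector)
  qed
qed

lemma partial_funpow_tensor:
  assumes "F i holomorphic_on UNIV"
  shows "(partial i ^^ n) (tensor F) = tensor (F(i := (deriv ^^ n) (F i)))"
proof (induction n)
  case (Suc n)
  let ?G = "F(i := (deriv ^^ n) (F i))"
  have "partial i (tensor ?G) = tensor (?G(i := deriv (?G i)))"
    by (rule partial_tensor) (simp add: holomorphic_higher_deriv[OF assms open_UNIV])
  then show ?case using Suc by (simp add: fun_upd_def cong: if_cong)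
qed simp

text \<open>Each coordinate occurs exactly once in the enumeration chosen by
  \<open>mpartial\<close>. The induction over a distinct list records which factors have been
  differentiated so far.\<close>

lemma mpartial_tensor:
  fixes F :: "'n::finite \<Rightarrow> complex \<Rightarrow> complex"
  assumes hol: "\<And>j. F j holomorphic_on UNIV"
  shows "mpartial \<alpha> (tensor F) = tensor (\<lambda>j. (deriv ^^ \<alpha> j) (F j))"
proof -
  have *: "foldr (\<lambda>i. partial i ^^ \<alpha> i) xs (tensor F) =
      tensor (\<lambda>j. if j \<in> set xs then (deriv ^^ \<alpha> j) (F j) else F j)" if "distinct xs" for xs
    using that
  proof (induction xs)
    case (Cons i xs)
    let ?G = "\<lambda>j. if j \<in> set xs then (deriv ^^ \<alpha> j) (F j) else F j"
    have "?G i holomorphic_on UNIV" using hol Cons by simp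
    then have "(partial i ^^ \<alpha> i) (tensor ?G) = tensor (?G(i := (deriv ^^ \<alpha> i) (?G i)))"
      by (rule partial_funpow_tensor)
    also have "?G(i := (deriv ^^ \<alpha> i) (?G i)) = (\<lambda>j. if j \<in> set (i # xs) then (deriv ^^ \<alpha> j) (F j) else F j)"
      using Cons by (auto simp: fun_eq_iff)
    finally show ?case using Cons by simp
  qed simp
  have "\<exists>xs. set xs = (UNIV :: 'n set) \<and> distinct xs"
    using finite_distinct_list[of "UNIV :: 'n set"] by simp
  then have "set (SOME xs. set xs = (UNIV :: 'n set) \<and> distinct xs) = UNIV \<and>
      distinct (SOME xs. set xs = (UNIV :: 'n set) \<and> distinct xs)"
    by (rule someI_ex)
  then show ?thesis unfolding mpartial_def by (subst *) auto
qed

section \<open>Gaussians\<close>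

text \<open>One family for both sides of the Fourier transform: real \<open>c\<close>,
  \<open>w\<close> give the factors of a shifted Gaussian, imaginary \<open>w\<close> gives the
  factors of its transform.\<close>

definition gexp :: "complex \<Rightarrow> complex \<Rightarrow> complex \<Rightarrow> complex" where
  "gexp c w u = exp (c + w * u - u\<^sup>2 / 2)"

lemma holomorphic_gexp [simp]: "gexp c w holomorphic_on A"
  unfolding gexp_def by (intro holomorphic_intros) auto

text \<open>On the unit circle around a real \<open>x\<close> one has
  \<open>(Re u)\<^sup>2 \<ge> x\<^sup>2 - 2 * \<bar>x\<bar>\<close> and
  \<open>(Im u)\<^sup>2 \<le> 1\<close>. The quadratic decay in \<open>x\<close> therefore beats the
  linear terms, at any prescribed rate \<open>L\<close>.\<close>

lemma gexp_sphere_bound: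
  assumes "norm (of_real x - u) = 1"
  shows "norm (gexp c w u) \<le> exp ((norm c + norm w + 1/2 + (norm w + 1 + L)\<^sup>2 / 2) - L * \<bar>x\<bar>)"
proof -
  have u: "norm u \<le> \<bar>x\<bar> + 1"
    using norm_triangle_ineq4[of "of_real x" "of_real x - u"] assms by simp
  have "\<bar>Re u - x\<bar> \<le> 1" using abs_Re_le_cmod[of "of_real x - u"] assms by simp
  then have "x * (Re u - x) \<ge> - \<bar>x\<bar>"
    using mult_left_mono[of "\<bar>Re u - x\<bar>" 1 "\<bar>x\<bar>"] abs_le_D2[of "x * (Re u - x)" "\<bar>x\<bar>"]
    by (simp add: abs_mult)
  moreover have "(Re u)\<^sup>2 \<ge> x\<^sup>2 + 2 * (x * (Re u - x))"
    using zero_le_power2[of "Re u - x"] by (simp add: power2_eq_square algebra_simps)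
  ultimately have re: "(Re u)\<^sup>2 \<ge> x\<^sup>2 - 2 * \<bar>x\<bar>" by linarith
  have "\<bar>Im u\<bar> \<le> 1" using abs_Im_le_cmod[of "of_real x - u"] assms by simp
  then have im: "(Im u)\<^sup>2 \<le> 1" by (simp add: abs_square_le_1)
  have "Re (w * u) \<le> norm w * (\<bar>x\<bar> + 1)"
    using complex_Re_le_cmod[of "w * u"] mult_left_mono[OF u norm_ge_zero[of w]] by (simp add: norm_mult)
  moreover have "Re c \<le> norm c" by (rule complex_Re_le_cmod)
  moreover have "Re (u\<^sup>2) = (Re u)\<^sup>2 - (Im u)\<^sup>2" by (simp add: power2_eq_square)
  moreover have "Re (c + w * u - u\<^sup>2 / 2) = Re c + Re (w * u) - Re (u\<^sup>2) / 2"
    by (simp only: plus_complex.sel minus_complex.sel Re_divide_numeral)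
  moreover have "Re (u\<^sup>2) / 2 \<ge> (x\<^sup>2 - 2 * \<bar>x\<bar>) / 2 - 1/2" if "Re (u\<^sup>2) = (Re u)\<^sup>2 - (Im u)\<^sup>2"
    unfolding that diff_divide_distrib[symmetric] using re im by (intro divide_right_mono diff_mono) auto
  ultimately have "Re (c + w * u - u\<^sup>2 / 2) \<le> norm c + norm w * (\<bar>x\<bar> + 1) - ((x\<^sup>2 - 2 * \<bar>x\<bar>) / 2 - 1/2)"
    by (metis add_mono diff_mono)
  also have "\<dots> = norm c + norm w + 1/2 + ((norm w + 1) * \<bar>x\<bar> - x\<^sup>2 / 2)"
    by (simp add: field_simps)
  \<comment> \<open>Completing the square at \<open>\<bar>x\<bar> = norm w + 1 + L\<close>.\<close>
  also have "(norm w + 1) * \<bar>x\<bar> - x\<^sup>2 / 2 \<le> (norm w + 1 + L)\<^sup>2 / 2 - L * \<bar>x\<bar>"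
    using zero_le_power2[of "\<bar>x\<bar> - (norm w + 1 + L)"] by (simp add: power2_eq_square field_simps)
  finally show ?thesis by (simp add: gexp_def)
qed

text \<open>Cauchy's inequality on circles of radius 1 leaves the factorial as the only dependence
  on \<open>k\<close>.\<close>

lemma gexp_deriv_bound:
  "\<exists>C\<ge>0. \<forall>k x. norm ((deriv ^^ k) (gexp c w) (of_real x)) \<le> C * fact k * exp (- L * \<bar>x\<bar>)"
proof -
  let ?C = "exp (norm c + norm w + 1/2 + (norm w + 1 + L)\<^sup>2 / 2)"
  have "norm ((deriv ^^ k) (gexp c w) (of_real x)) \<le> ?C * fact k * exp (- L * \<bar>x\<bar>)" for k x
  proof -
    have "norm ((deriv ^^ k) (gexp c w) (of_real x)) \<le>
        fact k * exp ((norm c + norm w + 1/2 + (norm w + 1 + L)\<^sup>2 / 2) - L * \<bar>x\<bar>) / 1 ^ k"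
      by (intro Cauchy_inequality gexp_sphere_bound holomorphic_on_imp_continuous_on) auto
    also have "\<dots> = ?C * fact k * exp (- L * \<bar>x\<bar>)"
      unfolding diff_conv_add_uminus exp_add by simp
    finally show ?thesis .
  qed
  then show ?thesis by (intro exI[of _ ?C]) auto
qed

text \<open>Their quotient is a multinomial coefficient; the induction uses that
  \<open>fact a * fact b\<close> divides \<open>fact (a + b)\<close>.\<close>

lemma prod_fact_le_fact_sum:
  assumes "finite A"
  shows "(\<Prod>j\<in>A. fact (\<alpha> j)) \<le> (fact (\<Sum>j\<in>A. \<alpha> j) :: real)"
  using assms
proof induction
  case (insert j A)
  have "fact (\<alpha> j) * (\<Prod>j\<in>A. fact (\<alpha> j)) \<le> fact (\<alpha> j) * (fact (\<Sum>j\<in>A. \<alpha> j) :: real)"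
    using insert.IH by (rule mult_left_mono) simp
  also have "fact (\<alpha> j) * fact (\<Sum>j\<in>A. \<alpha> j) \<le> (fact (\<alpha> j + (\<Sum>j\<in>A. \<alpha> j)) :: nat)"
    by (intro dvd_imp_le fact_fact_dvd_fact) simp
  then have "fact (\<alpha> j) * fact (\<Sum>j\<in>A. \<alpha> j) \<le> (fact (\<alpha> j + (\<Sum>j\<in>A. \<alpha> j)) :: real)"
    by (metis of_nat_fact of_nat_le_iff of_nat_mult)
  finally show ?case using insert.hyps by simp
qed simp

text \<open>Captures what a Gaussian and its Fourier transform share: the factorial is absorbed by
  the Young factors, and decay at every exponential rate absorbs every weight
  \<open>exp (l * \<omega>)\<close>, as \<omega> grows at most linearly.\<close>

definition rapid :: "(real^'n::finite \<Rightarrow> complex) \<Rightarrow> bool" where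
  "rapid f \<longleftrightarrow> smooth f \<and> (\<forall>L\<ge>0. \<exists>C\<ge>0. \<forall>\<alpha> x.
     norm (mpartial \<alpha> f x) \<le> C * fact (morder \<alpha>) * exp (- L * norm x))"

lemma rapid_tensor_gexp: "rapid (tensor (\<lambda>j. gexp (c j) (w j)))"
  unfolding rapid_def
proof (intro conjI allI impI)
  let ?F = "\<lambda>j. gexp (c j) (w j)"
  show "smooth (tensor ?F)" by (rule smooth_tensor) simp
  fix L :: real assume "L \<ge> 0"
  have "\<forall>j. \<exists>C\<ge>0. \<forall>k x. norm ((deriv ^^ k) (?F j) (of_real x)) \<le> C * fact k * exp (- L * \<bar>x\<bar>)"
    using gexp_deriv_bound by blast
  then obtain C where C: "\<And>j. C j \<ge> 0"
    "\<And>j k x. norm ((deriv ^^ k) (?F j) (of_real x)) \<le> C j * fact k * exp (- L * \<bar>x\<bar>)"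
    by metis
  have "norm (mpartial \<alpha> (tensor ?F) x) \<le> (\<Prod>j\<in>UNIV. C j) * fact (morder \<alpha>) * exp (- L * norm x)" for \<alpha> x
  proof -
    have "norm (mpartial \<alpha> (tensor ?F) x) = (\<Prod>j\<in>UNIV. norm ((deriv ^^ \<alpha> j) (?F j) (of_real (x $ j))))"
      by (subst mpartial_tensor) (simp_all add: tensor_def prod_norm)
    also have "\<dots> \<le> (\<Prod>j\<in>UNIV. C j * fact (\<alpha> j) * exp (- L * \<bar>x $ j\<bar>))"
      using C by (intro prod_mono) auto
    also have "\<dots> = (\<Prod>j\<in>UNIV. C j) * ((\<Prod>j\<in>UNIV. fact (\<alpha> j)) * exp (- L * (\<Sum>j\<in>UNIV. \<bar>x $ j\<bar>)))"
      by (simp only: sum_distrib_left exp_sum[OF finite] prod.distrib mult.assoc)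
    \<comment> \<open>The product gives decay in the l1 norm, which dominates the Euclidean norm;
      the sign of \<open>L\<close> matters here.\<close>
    also have "\<dots> \<le> (\<Prod>j\<in>UNIV. C j) * (fact (morder \<alpha>) * exp (- L * norm x))"
      unfolding morder_def using C(1) norm_le_l1_cart[of x] \<open>L \<ge> 0\<close>
      by (intro mult_left_mono mult_mono prod_fact_le_fact_sum prod_nonneg) (auto intro: mult_left_mono)
    finally show ?thesis by (simp add: mult.assoc)
  qed
  then show "\<exists>C\<ge>0. \<forall>\<alpha> x. norm (mpartial \<alpha> (tensor ?F) x) \<le> C * fact (morder \<alpha>) * exp (- L * norm x)"
    using C(1) by (intro exI[of _ "\<Prod>j\<in>UNIV. C j"]) (auto intro: prod_nonneg)
qed

text \<open>This is \<open>exp (- \<bar>x + z\<bar>\<^sup>2 / 2)\<close>, expanded coordinate by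
  coordinate; it is centred at \<open>- z\<close>.\<close>

definition gauss :: "real^'n::finite \<Rightarrow> real^'n \<Rightarrow> complex" where
  "gauss z = tensor (\<lambda>j. gexp (- of_real ((z $ j)\<^sup>2 / 2)) (- of_real (z $ j)))"

lemma gauss_translate: "gauss z (x + y) = gauss (z + y) x"
  unfolding gauss_def tensor_def gexp_def
  by (intro prod.cong refl arg_cong[of _ _ exp]) (simp add: power2_eq_square field_simps)

lemma gauss_0_0: "gauss 0 0 = 1"
  by (simp add: gauss_def tensor_def gexp_def)

lemma rapid_gauss: "rapid (gauss z)"
  unfolding gauss_def by (rule rapid_tensor_gexp)

text \<open>Fubini for products. Lebesgue measure on \<open>real^'n\<close> is an image of a product
  measure indexed by \<open>Basis\<close>, so coordinates are first matched with basis
  vectors.\<close>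

lemma lborel_tensor:
  fixes h :: "'n::finite \<Rightarrow> real \<Rightarrow> complex"
  assumes int: "\<And>j. integrable lborel (h j)"
  shows "integrable lborel (\<lambda>x :: real^'n. \<Prod>j\<in>UNIV. h j (x $ j))"
    and "(\<integral>x. (\<Prod>j\<in>UNIV. h j ((x :: real^'n) $ j)) \<partial>lborel) = (\<Prod>j\<in>UNIV. \<integral>t. h j t \<partial>lborel)"
proof -
  interpret product_sigma_finite "\<lambda>_::real^'n. lborel :: real measure" ..
  let ?g = "\<lambda>b :: real^'n. h (axis_index b)"
  let ?T = "\<lambda>f. \<Sum>b\<in>Basis. f b *\<^sub>R b :: real^'n"
  have Basis: "Basis = range (\<lambda>j. axis j 1 :: real^'n)" by (auto simp: Basis_vec_def)
  have inj: "inj (\<lambda>j. axis j 1 :: real^'n)" by (auto simp: inj_on_def axis_eq_axis)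
  have ai: "axis_index (axis j 1 :: real^'n) = j" for j by (simp add: axis_index_axis)
  have comp: "(\<Prod>j\<in>UNIV. h j ((?T f) $ j)) = (\<Prod>b\<in>Basis. ?g b (f b))" for f
  proof -
    have "(?T f) $ j = f (axis j 1)" for j
    proof -
      have "(?T f) $ j = (?T f) \<bullet> axis j 1" by (simp add: inner_axis)
      also have "\<dots> = f (axis j 1)" by (subst inner_sum_left_Basis) auto
      finally show ?thesis .
    qed
    then show ?thesis unfolding Basis by (subst prod.reindex[OF inj]) (simp add: ai)
  qed
  have meas: "?T \<in> measurable (\<Pi>\<^sub>M b\<in>Basis. lborel) borel" by measurable
  have hm: "h j \<in> borel_measurable borel" for j
    using borel_measurable_integrable[OF int[of j]] by simp
  have meas': "(\<lambda>x :: real^'n. \<Prod>j\<in>UNIV. h j (x $ j)) \<in> borel_measurable borel"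
    by (intro borel_measurable_prod measurable_compose[OF _ hm]) measurable
  have "integrable (\<Pi>\<^sub>M b\<in>Basis. lborel) (\<lambda>f. \<Prod>b\<in>Basis. ?g b (f b))"
    by (rule product_integrable_prod) (auto intro: int)
  then show "integrable lborel (\<lambda>x :: real^'n. \<Prod>j\<in>UNIV. h j (x $ j))"
    by (subst lborel_eq, subst integrable_distr_eq[OF meas meas']) (simp only: comp)
  have "(\<integral>x. (\<Prod>j\<in>UNIV. h j ((x :: real^'n) $ j)) \<partial>lborel) =
      (\<integral>f. (\<Prod>b\<in>Basis. ?g b (f b)) \<partial>(\<Pi>\<^sub>M b\<in>Basis. lborel))"
    by (subst lborel_eq, subst integral_distr[OF meas meas']) (simp only: comp)
  also have "\<dots> = (\<Prod>b\<in>Basis. \<integral>t. ?g b t \<partial>lborel)"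
    by (rule product_integral_prod) (auto intro: int)
  also have "\<dots> = (\<Prod>j\<in>UNIV. \<integral>t. h j t \<partial>lborel)"
    unfolding Basis by (subst prod.reindex[OF inj]) (simp add: ai)
  finally show "(\<integral>x. (\<Prod>j\<in>UNIV. h j ((x :: real^'n) $ j)) \<partial>lborel) = (\<Prod>j\<in>UNIV. \<integral>t. h j t \<partial>lborel)" .
qed

text \<open>The characteristic function of the standard normal distribution is
  \<open>exp (- \<xi>\<^sup>2 / 2)\<close>; the shift by \<open>z\<close> contributes a
  phase.\<close>

lemma gauss_fourier_1:
  fixes z \<xi> :: real
  defines "k \<equiv> \<lambda>t. cis (- (t * \<xi>)) * gexp (- of_real (z\<^sup>2 / 2)) (- of_real z) (of_real t)"
  shows "integrable lborel k"
    and "integral\<^sup>L lborel k = gexp (of_real (ln (sqrt (2 * pi)))) (\<i> * of_real z) (of_real \<xi>)"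
proof -
  let ?e = "\<lambda>s. std_normal_density s *\<^sub>R iexp (- \<xi> * s)"
  have "has_bochner_integral std_normal_distribution (\<lambda>s. iexp (- \<xi> * s)) (char std_normal_distribution (- \<xi>))"
    unfolding char_def has_bochner_integral_iff
    by (intro conjI refl prob_space.integrable_iexp) (auto simp: prob_space_normal_density)
  then have "integrable lborel ?e" and int: "integral\<^sup>L lborel ?e = exp (- (\<xi>\<^sup>2) / 2)"
    by (simp_all add: has_bochner_integral_iff char_std_normal_distribution integrable_density integral_density)
  then have e: "has_bochner_integral lborel ?e (exp (- (\<xi>\<^sup>2) / 2))"
    by (simp add: has_bochner_integral_iff)
  have "has_bochner_integral lborel (\<lambda>t. ?e (z + 1 * t)) (of_real (exp (- (\<xi>\<^sup>2) / 2)) /\<^sub>R \<bar>1\<bar>)"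
    using lborel_has_bochner_integral_real_affine_iff[of 1 ?e _ z] e by simp
  \<comment> \<open>The factor \<open>sqrt (2 * pi)\<close> cancels the normalization of the
    density, and \<open>cis (z * \<xi>)\<close> cancels the phase produced by the substitution
    \<open>s = z + t\<close>.\<close>
  then have "has_bochner_integral lborel (\<lambda>t. (of_real (sqrt (2 * pi)) * cis (z * \<xi>)) * ?e (z + 1 * t))
     ((of_real (sqrt (2 * pi)) * cis (z * \<xi>)) * (of_real (exp (- (\<xi>\<^sup>2) / 2)) /\<^sub>R \<bar>1\<bar>))"
    by (rule has_bochner_integral_mult_right)
  moreover have "(of_real (sqrt (2 * pi)) * cis (z * \<xi>)) * ?e (z + 1 * t) = k t" for t
  proof -
    have "gexp (- of_real (z\<^sup>2 / 2)) (- of_real z) (of_real t) = of_real (exp (- (z + t)\<^sup>2 / 2))"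
      unfolding gexp_def of_real_exp
      by (intro arg_cong[of _ _ exp]) (simp add: power2_eq_square field_simps)
    moreover have "cis (z * \<xi>) * iexp (- \<xi> * (z + t)) = cis (- (t * \<xi>))"
      by (simp add: cis_conv_exp flip: exp_add) (simp add: algebra_simps)
    ultimately show ?thesis unfolding k_def normal_density_def
      by (simp add: scaleR_conv_of_real field_simps)
  qed
  moreover have "(of_real (sqrt (2 * pi)) * cis (z * \<xi>)) * (of_real (exp (- (\<xi>\<^sup>2) / 2)) /\<^sub>R \<bar>1\<bar>) =
      gexp (of_real (ln (sqrt (2 * pi)))) (\<i> * of_real z) (of_real \<xi>)"
  proof -
    \<comment> \<open>The constant moves into the exponent so that the transform is again a
      \<open>gexp\<close>.\<close>
    have "complex_of_real (sqrt (2 * pi)) = exp (of_real (ln (sqrt (2 * pi))))"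
      by (subst exp_of_real) (subst exp_ln, auto)
    then show ?thesis
      by (simp add: gexp_def cis_conv_exp exp_of_real[symmetric] mult.assoc flip: exp_add)
  qed
  ultimately show "integrable lborel k"
    "integral\<^sup>L lborel k = gexp (of_real (ln (sqrt (2 * pi)))) (\<i> * of_real z) (of_real \<xi>)"
    by (simp_all add: has_bochner_integral_iff)
qed

section \<open>Fourier transform and integrability in several variables\<close>

lemma cis_sum: "finite A \<Longrightarrow> cis (sum f A) = (\<Prod>j\<in>A. cis (f j))"
  by (induction A rule: finite_induct) (auto simp flip: cis_mult)

lemma fourier_gauss:
  "fourier (gauss z) = tensor (\<lambda>j. gexp (of_real (ln (sqrt (2 * pi)))) (\<i> * of_real (z $ j)))"
proof
  fix \<xi>
  let ?h = "\<lambda>j t. cis (- (t * \<xi> $ j)) * gexp (- of_real ((z $ j)\<^sup>2 / 2)) (- of_real (z $ j)) (of_real t)"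
  have "cis (- (x \<bullet> \<xi>)) * gauss z x = (\<Prod>j\<in>UNIV. ?h j (x $ j))" for x
    by (simp add: gauss_def tensor_def prod.distrib inner_vec_def cis_sum flip: sum_negf)
  then have "fourier (gauss z) \<xi> = (\<integral>x. (\<Prod>j\<in>UNIV. ?h j (x $ j)) \<partial>lborel)"
    unfolding fourier_def by simp
  also have "\<dots> = (\<Prod>j\<in>UNIV. \<integral>t. ?h j t \<partial>lborel)"
    by (rule lborel_tensor(2)) (rule gauss_fourier_1(1))
  finally show "fourier (gauss z) \<xi> =
      tensor (\<lambda>j. gexp (of_real (ln (sqrt (2 * pi)))) (\<i> * of_real (z $ j))) \<xi>"
    by (simp only: gauss_fourier_1(2) tensor_def)
qed

text \<open>At frequency \<open>\<xi> = 0\<close> the one-dimensional integrand is the Gaussian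
  factor itself.\<close>

lemma integrable_gauss: "integrable lborel (gauss z)"
  using lborel_tensor(1)[OF gauss_fourier_1(1)[where \<xi> = 0], of "\<lambda>j. z $ j"]
  by (simp add: gauss_def[abs_def] tensor_def[abs_def])

section \<open>Weights\<close>

lemma weight_basic:
  assumes "nonquasianalytic_weight \<omega>"
  shows weight_mono: "\<lbrakk>0 \<le> s; s \<le> t\<rbrakk> \<Longrightarrow> \<omega> s \<le> \<omega> t"
    and weight_nonneg: "0 \<le> t \<Longrightarrow> \<omega> t \<ge> 0"
    and weight_norm_nonneg: "\<omega> (norm (x :: 'a::real_normed_vector)) \<ge> 0"
    and weight_vanishes: "\<lbrakk>0 \<le> t; t \<le> 1\<rbrakk> \<Longrightarrow> \<omega> t = 0"
  using assms unfolding nonquasianalytic_weight_def mono_on_def by auto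

lemma weight_unbounded:
  assumes "nonquasianalytic_weight \<omega>"
  obtains t where "t \<ge> 0" "\<omega> t \<ge> M"
proof -
  obtain a b where ab: "b > 0" "\<And>t. t \<ge> 0 \<Longrightarrow> \<omega> t \<ge> a + b * ln (1 + t)"
    using assms unfolding nonquasianalytic_weight_def by auto
  \<comment> \<open>Chosen so that \<open>a + b * r \<ge> M\<close>; at the point
    \<open>exp r - 1\<close> the term \<open>ln (1 + t)\<close> equals \<open>r\<close>.\<close>
  define r where "r = max 0 ((M - a) / b)"
  have "b * r \<ge> M - a" using ab(1) by (simp add: r_def max_def field_simps)
  then have "\<omega> (exp r - 1) \<ge> M" using ab(2)[of "exp r - 1"] by (simp add: r_def)
  then show ?thesis using that[of "exp r - 1"] by (simp add: r_def)
qed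

text \<open>Since \<open>\<omega>\<close> increases, \<open>\<omega> T / (5 T)\<close> is at most the integral of \<open>\<omega> t / (1 + t\<^sup>2)\<close> over
  \<open>[T, 2 T]\<close>, which tends to \<open>0\<close>.\<close>

lemma weight_sublinear:
  assumes w: "nonquasianalytic_weight \<omega>" and "\<epsilon> > 0"
  obtains C where "C \<ge> 0" "\<And>t. t \<ge> 0 \<Longrightarrow> \<omega> t \<le> \<epsilon> * t + C"
proof -
  let ?f = "\<lambda>t. \<omega> t / (1 + t\<^sup>2)"
  let ?I = "\<lambda>b. set_lebesgue_integral lborel {1..b} ?f"
  have int: "set_integrable lborel {1..} ?f"
    using w unfolding nonquasianalytic_weight_def by auto
  then have lim: "(?I \<longlongrightarrow> set_lebesgue_integral lborel {1..} ?f) at_top"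
    by (intro tendsto_set_lebesgue_integral_at_top) auto
  then have "((\<lambda>b. ?I (2 * b)) \<longlongrightarrow> set_lebesgue_integral lborel {1..} ?f) at_top"
    by (rule filterlim_compose) real_asymp
  from tendsto_diff[OF this lim] have "((\<lambda>b. ?I (2 * b) - ?I b) \<longlongrightarrow> 0) at_top" by simp
  then have "\<forall>\<^sub>F b in at_top. ?I (2 * b) - ?I b < \<epsilon> / 5"
    using \<open>\<epsilon> > 0\<close> by (intro order_tendstoD(2)) auto
  then obtain T0 where T0: "\<And>b. b \<ge> T0 \<Longrightarrow> ?I (2 * b) - ?I b < \<epsilon> / 5"
    unfolding eventually_at_top_linorder by blast
  define T1 where "T1 = max 1 T0"
  have large: "\<omega> T \<le> \<epsilon> * T" if T: "T \<ge> T1" for T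
  proof -
    have T1: "T \<ge> 1" "T \<ge> T0" using T by (auto simp: T1_def)
    have int': "set_integrable lborel A ?f" if "A \<subseteq> {1..}" "A \<in> sets lborel" for A
      using set_integrable_subset[OF int] that by blast
    have "\<omega> T / (5 * T) = set_lebesgue_integral lborel {T<..2 * T} (\<lambda>t. \<omega> T / (5 * T\<^sup>2))"
      using T1 by (simp add: set_lebesgue_integral_def power2_eq_square field_simps)
    also have "\<dots> \<le> set_lebesgue_integral lborel {T<..2 * T} ?f"
    proof (rule set_integral_mono)
      show "set_integrable lborel {T<..2 * T} (\<lambda>t. \<omega> T / (5 * T\<^sup>2))"
        unfolding set_integrable_def by (intro integrable_scaleR_left integrable_real_indicator) (use T1 in auto)
      fix t assume t: "t \<in> {T<..2 * T}"
      \<comment> \<open>Source of the 5: \<open>t \<le> 2 * T\<close> and \<open>T \<ge> 1\<close>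
        bound \<open>1 + t\<^sup>2\<close> by \<open>T\<^sup>2 + 4 * T\<^sup>2\<close>.\<close>
      have "t\<^sup>2 \<le> (2 * T)\<^sup>2" by (rule power_mono) (use t T1 in auto)
      moreover have "1 \<le> T\<^sup>2" using T1 by simp
      ultimately have "1 + t\<^sup>2 \<le> 5 * T\<^sup>2" by (simp add: power2_eq_square)
      then show "\<omega> T / (5 * T\<^sup>2) \<le> \<omega> t / (1 + t\<^sup>2)"
        using t T1
        by (intro frac_le weight_mono[OF w] weight_nonneg[OF w]) (auto intro: add_pos_nonneg)
    qed (use T1 in \<open>auto intro!: int'\<close>)
    also have "\<dots> = ?I (2 * T) - ?I T"
    proof -
      have "{1..2 * T} = {1..T} \<union> {T<..2 * T}" using T1 by auto
      then have "?I (2 * T) = ?I T + set_lebesgue_integral lborel {T<..2 * T} ?f"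
        using T1 by (auto intro!: set_integral_Un int')
      then show ?thesis by simp
    qed
    also have "\<dots> < \<epsilon> / 5" by (rule T0[OF T1(2)])
    finally show ?thesis using T1 by (simp add: field_simps)
  qed
  show ?thesis
  proof (rule that)
    \<comment> \<open>Below \<open>T1\<close> monotonicity bounds \<omega> by the constant
      \<open>\<omega> T1\<close>; beyond it \<open>large\<close> applies.\<close>
    show "\<omega> T1 \<ge> 0" by (rule weight_nonneg[OF w]) (simp add: T1_def)
    fix t :: real assume t: "t \<ge> 0"
    show "\<omega> t \<le> \<epsilon> * t + \<omega> T1"
    proof (cases "t \<le> T1")
      case True
      then show ?thesis using weight_mono[OF w t] t \<open>\<epsilon> > 0\<close> by (simp add: add_increasing)
    next
      case False
      then show ?thesis using large[of t] \<open>\<omega> T1 \<ge> 0\<close> by simp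
    qed
  qed
qed

section \<open>Young conjugates against factorial growth\<close>

lemma young_factor_nonneg [simp]: "young_factor \<omega> m k \<ge> 0"
  by (simp add: young_factor_def Let_def)

text \<open>The supremum of \<open>- \<omega> (exp t)\<close> is attained at \<open>t = 0\<close>,
  where \<omega> vanishes by normalization.\<close>

lemma young_conj_0:
  assumes "nonquasianalytic_weight \<omega>"
  shows "young_conj \<omega> 0 = 0"
  unfolding young_conj_def
proof (rule antisym)
  show "(SUP t\<in>{0..}. ereal (0 * t - \<omega> (exp t))) \<le> 0"
    by (auto intro!: SUP_least weight_nonneg[OF assms])
  have "ereal (0 * 0 - \<omega> (exp 0)) \<le> (SUP t\<in>{0..}. ereal (0 * t - \<omega> (exp t)))"
    by (intro SUP_upper) auto
  then show "0 \<le> (SUP t\<in>{0..}. ereal (0 * t - \<omega> (exp t)))"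
    using weight_vanishes[OF assms, of 1] by (simp add: zero_ereal_def)
qed

lemma young_factor_0 [simp]:
  assumes "nonquasianalytic_weight \<omega>"
  shows "young_factor \<omega> m 0 = 1"
  using young_conj_0[OF assms] by (simp add: young_factor_def)

text \<open>Young's inequality at \<open>t = ln r\<close>, which is admissible because
  \<open>r \<ge> 1\<close>. An infinite conjugate makes the factor 0.\<close>

lemma young_factor_le:
  assumes "m \<ge> 1" "r \<ge> 1"
  shows "young_factor \<omega> m k * r ^ k \<le> exp (real m * \<omega> r)"
proof -
  let ?s = "young_conj \<omega> (real k / real m)"
  have s: "ereal (real k / real m * ln r - \<omega> r) \<le> ?s"
    unfolding young_conj_def using assms by (intro SUP_upper2[of "ln r"]) auto
  show ?thesis
  proof (cases ?s)
    case (real s)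
    then have "real k / real m * ln r - \<omega> r \<le> s" using s by simp
    then have "real k * ln r - real m * s \<le> real m * \<omega> r" using assms by (simp add: field_simps)
    moreover have "young_factor \<omega> m k * r ^ k = exp (real k * ln r - real m * s)"
      using real assms by (simp add: young_factor_def exp_diff exp_minus exp_of_nat_mult field_simps)
    ultimately show ?thesis by simp
  next
    case MInf
    then show ?thesis using s by simp
  qed (simp add: young_factor_def)
qed

text \<open>\<open>young_factor_le\<close> at \<open>r = 4 * k\<close> bounds the factor times
  \<open>(4 * k) ^ k\<close> by a constant times \<open>exp k\<close>, while
  \<open>exp k * fact k \<le> (3 * k) ^ k\<close>.\<close>

lemma young_factor_fact_bound:
  assumes "nonquasianalytic_weight \<omega>" "m \<ge> 1"
  obtains C where "C \<ge> 0" "\<And>k. young_factor \<omega> m k * fact k \<le> C"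
proof -
  have m: "real m > 0" using assms by simp
  \<comment> \<open>The slope is chosen to make \<open>m * \<omega> (4 * k)\<close> at most
    \<open>k + m * D\<close>.\<close>
  then obtain D where D: "D \<ge> 0" "\<And>t. t \<ge> 0 \<Longrightarrow> \<omega> t \<le> 1 / (4 * real m) * t + D"
    using weight_sublinear[OF assms(1), of "1 / (4 * real m)"] by auto
  have "young_factor \<omega> m k * fact k \<le> exp (real m * D)" for k
  proof (cases "k = 0")
    case True
    then show ?thesis using assms D by simp
  next
    case False
    let ?r = "4 * real k"
    have "young_factor \<omega> m k * ?r ^ k \<le> exp (real m * \<omega> ?r)"
      using False assms by (intro young_factor_le) auto
    also have "\<omega> ?r \<le> 1 / (4 * real m) * ?r + D"
      by (rule D(2)) simp
    then have "real m * \<omega> ?r \<le> real m * (1 / (4 * real m) * ?r + D)"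
      by (rule mult_left_mono) simp
    also have "\<dots> = real k + real m * D" using m by (simp add: field_simps)
    finally have 1: "young_factor \<omega> m k * ?r ^ k \<le> exp (real k) * exp (real m * D)"
      by (simp add: exp_add)
    have "exp (real k) * (fact k :: real) \<le> 3 ^ k * real k ^ k"
    proof (rule mult_mono)
      have "exp (real k) = exp 1 ^ k" using exp_of_nat_mult[of k "1 :: real"] by simp
      also have "\<dots> \<le> 3 ^ k" by (intro power_mono exp_le) auto
      finally show "exp (real k) \<le> 3 ^ k" .
      show "(fact k :: real) \<le> real k ^ k" using fact_le_power[of k] by simp
    qed auto
    also have "\<dots> \<le> ?r ^ k" by (simp add: power_mult_distrib mult_right_mono power_mono)
    finally have 2: "exp (real k) * (fact k :: real) \<le> ?r ^ k" .
    have "exp (real k) * (young_factor \<omega> m k * fact k) \<le> young_factor \<omega> m k * ?r ^ k"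
      using mult_left_mono[OF 2 young_factor_nonneg[of \<omega> m k]] by (simp add: mult_ac)
    also note 1
    finally show ?thesis by simp
  qed
  then show ?thesis by (intro that[of "exp (real m * D)"]) auto
qed

section \<open>The spaces of test functions\<close>

text \<open>The term of order zero in the supremum, where the Young factor is 1.\<close>

lemma le_O_norm:
  assumes "nonquasianalytic_weight \<omega>"
  shows "ennreal (norm (f x) * exp (- (real n * \<omega> (norm x)))) \<le> O_norm \<omega> m n f"
  unfolding O_norm_def using assms
  by (intro SUP_upper2[of "\<lambda>_. 0"] SUP_upper2[of x]) auto

lemma le_S_norm:
  assumes "nonquasianalytic_weight \<omega>"
  shows "ennreal (exp (real n * \<omega> (norm x)) * norm (f x)) \<le> S_norm \<omega> m n f"
  unfolding S_norm_def using assms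
  by (intro SUP_upper2[of "\<lambda>_. 0"]) (auto intro: SUP_upper)

lemma ennreal_lincomb_le:
  assumes "x \<le> a * b + c * d" "0 \<le> a" "0 \<le> b" "0 \<le> c" "0 \<le> d"
  shows "ennreal x \<le> ennreal a * ennreal b + ennreal c * ennreal d"
  using assms by (simp add: ennreal_leI flip: ennreal_mult ennreal_plus)

lemma O_norm_lincomb:
  assumes "smooth f" "smooth g"
  shows "O_norm \<omega> m n (\<lambda>x. a * f x + b * g x) \<le>
    ennreal (norm a) * O_norm \<omega> m n f + ennreal (norm b) * O_norm \<omega> m n g"
proof -
  let ?E = "\<lambda>\<alpha> x. exp (- (real n * \<omega> (norm x))) * young_factor \<omega> m (morder \<alpha>)"
  have "ennreal (norm (a * mpartial \<alpha> f x + b * mpartial \<alpha> g x) * exp (- (real n * \<omega> (norm x))) * young_factor \<omega> m (morder \<alpha>))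
      \<le> ennreal (norm a) * O_norm \<omega> m n f + ennreal (norm b) * O_norm \<omega> m n g" for \<alpha> x
  proof -
    have "norm (a * mpartial \<alpha> f x + b * mpartial \<alpha> g x) * ?E \<alpha> x
        \<le> (norm a * norm (mpartial \<alpha> f x) + norm b * norm (mpartial \<alpha> g x)) * ?E \<alpha> x"
      by (intro mult_right_mono) (auto simp: norm_mult intro: order_trans[OF norm_triangle_ineq])
    also have "\<dots> = norm a * (norm (mpartial \<alpha> f x) * ?E \<alpha> x) + norm b * (norm (mpartial \<alpha> g x) * ?E \<alpha> x)"
      by (simp add: algebra_simps)
    finally have "ennreal (norm (a * mpartial \<alpha> f x + b * mpartial \<alpha> g x) * ?E \<alpha> x)
        \<le> ennreal (norm a) * ennreal (norm (mpartial \<alpha> f x) * ?E \<alpha> x) + ennreal (norm b) * ennreal (norm (mpartial \<alpha> g x) * ?E \<alpha> x)"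
      by (intro ennreal_lincomb_le) auto
    also have "\<dots> \<le> ennreal (norm a) * O_norm \<omega> m n f + ennreal (norm b) * O_norm \<omega> m n g"
      unfolding O_norm_def mult.assoc
      by (intro add_mono mult_left_mono SUP_upper2[of \<alpha>] SUP_upper) auto
    finally show ?thesis by (simp add: mult.assoc)
  qed
  then show ?thesis
    unfolding O_norm_def[of \<omega> m n "\<lambda>x. a * f x + b * g x"] mpartial_lincomb[OF assms] by (intro SUP_least)
qed

lemma S_norm_lincomb:
  assumes "smooth f" "smooth g"
  shows "S_norm \<omega> m n (\<lambda>x. a * f x + b * g x) \<le>
    ennreal (norm a) * S_norm \<omega> m n f + ennreal (norm b) * S_norm \<omega> m n g"
proof -
  let ?N = "\<lambda>f \<alpha>. SUP x. ennreal (exp (real n * \<omega> (norm x)) * norm (mpartial \<alpha> f x))"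
  let ?Y = "\<lambda>\<alpha>. ennreal (young_factor \<omega> m (morder \<alpha>))"
  have "?N (\<lambda>x. a * f x + b * g x) \<alpha> * ?Y \<alpha>
      \<le> ennreal (norm a) * S_norm \<omega> m n f + ennreal (norm b) * S_norm \<omega> m n g" for \<alpha>
  proof -
    have "ennreal (exp (real n * \<omega> (norm x)) * norm (a * mpartial \<alpha> f x + b * mpartial \<alpha> g x))
        \<le> ennreal (norm a) * ?N f \<alpha> + ennreal (norm b) * ?N g \<alpha>" for x
    proof -
      let ?E = "exp (real n * \<omega> (norm x))"
      have "?E * norm (a * mpartial \<alpha> f x + b * mpartial \<alpha> g x)
          \<le> ?E * (norm a * norm (mpartial \<alpha> f x) + norm b * norm (mpartial \<alpha> g x))"
        by (intro mult_left_mono) (auto simp: norm_mult intro: order_trans[OF norm_triangle_ineq])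
      also have "\<dots> = norm a * (?E * norm (mpartial \<alpha> f x)) + norm b * (?E * norm (mpartial \<alpha> g x))"
        by (simp add: algebra_simps)
      finally have "ennreal (?E * norm (a * mpartial \<alpha> f x + b * mpartial \<alpha> g x))
          \<le> ennreal (norm a) * ennreal (?E * norm (mpartial \<alpha> f x)) + ennreal (norm b) * ennreal (?E * norm (mpartial \<alpha> g x))"
        by (intro ennreal_lincomb_le) auto
      also have "\<dots> \<le> ennreal (norm a) * ?N f \<alpha> + ennreal (norm b) * ?N g \<alpha>"
        by (intro add_mono mult_left_mono SUP_upper) auto
      finally show ?thesis .
    qed
    then have "?N (\<lambda>x. a * f x + b * g x) \<alpha> \<le> ennreal (norm a) * ?N f \<alpha> + ennreal (norm b) * ?N g \<alpha>"
      unfolding mpartial_lincomb[OF assms] by (intro SUP_least)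
    then have "?N (\<lambda>x. a * f x + b * g x) \<alpha> * ?Y \<alpha> \<le> (ennreal (norm a) * ?N f \<alpha> + ennreal (norm b) * ?N g \<alpha>) * ?Y \<alpha>"
      by (rule mult_right_mono) simp
    also have "\<dots> = ennreal (norm a) * (?N f \<alpha> * ?Y \<alpha>) + ennreal (norm b) * (?N g \<alpha> * ?Y \<alpha>)"
      by (simp add: distrib_right mult.assoc)
    also have "\<dots> \<le> ennreal (norm a) * S_norm \<omega> m n f + ennreal (norm b) * S_norm \<omega> m n g"
      unfolding S_norm_def by (intro add_mono mult_left_mono SUP_upper) auto
    finally show ?thesis .
  qed
  then show ?thesis
    unfolding S_norm_def[of \<omega> m n "\<lambda>x. a * f x + b * g x"] by (intro SUP_least)
qed

lemma O_norm_0 [simp]: "O_norm \<omega> m n (\<lambda>x. 0) = 0"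
  by (simp add: O_norm_def)

lemma S_norm_0 [simp]: "S_norm \<omega> m n (\<lambda>x. 0) = 0"
  by (simp add: S_norm_def)

text \<open>From \<open>\<omega> t \<le> t + D\<close> the weight is at most
  \<open>exp (l * D) * exp (l * norm x)\<close>, which decay at rate \<open>L = l\<close>
  cancels.\<close>

lemma rapid_weighted_bound:
  assumes w: "nonquasianalytic_weight \<omega>" and "rapid f" "l \<ge> 0"
  obtains C where "C \<ge> 0" "\<And>\<alpha> x. exp (l * \<omega> (norm x)) * norm (mpartial \<alpha> f x) \<le> C * fact (morder \<alpha>)"
proof -
  obtain D where D: "D \<ge> 0" "\<And>t. t \<ge> 0 \<Longrightarrow> \<omega> t \<le> 1 * t + D"
    using weight_sublinear[OF w, of 1] by auto
  obtain C where C: "C \<ge> 0" "\<And>\<alpha> x. norm (mpartial \<alpha> f x) \<le> C * fact (morder \<alpha>) * exp (- l * norm x)"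
    using assms(2,3) unfolding rapid_def by blast
  have "exp (l * \<omega> (norm x)) * norm (mpartial \<alpha> f x) \<le> (exp (l * D) * C) * fact (morder \<alpha>)" for \<alpha> x
  proof -
    have "exp (l * \<omega> (norm x)) * norm (mpartial \<alpha> f x) \<le>
        exp (l * (1 * norm x + D)) * (C * fact (morder \<alpha>) * exp (- l * norm x))"
      using C D assms(3) by (intro mult_mono) (auto intro!: mult_left_mono)
    also have "\<dots> = (exp (l * D) * C) * fact (morder \<alpha>)"
      by (simp add: distrib_left exp_add exp_minus field_simps)
    finally show ?thesis .
  qed
  then show ?thesis using C(1) by (intro that[of "exp (l * D) * C"]) auto
qed

lemma S_norm_rapid_finite:
  assumes w: "nonquasianalytic_weight \<omega>" and "rapid f" "m \<ge> 1"
  shows "S_norm \<omega> m n f < \<infinity>"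
proof -
  obtain C where C: "C \<ge> 0" "\<And>\<alpha> x. exp (real n * \<omega> (norm x)) * norm (mpartial \<alpha> f x) \<le> C * fact (morder \<alpha>)"
    using rapid_weighted_bound[OF w \<open>rapid f\<close>, of "real n"] by auto
  obtain Y where Y: "Y \<ge> 0" "\<And>k. young_factor \<omega> m k * fact k \<le> Y"
    using young_factor_fact_bound[OF w \<open>m \<ge> 1\<close>] by blast
  have "S_norm \<omega> m n f \<le> ennreal (C * Y)"
    unfolding S_norm_def
  proof (rule SUP_least)
    fix \<alpha> :: "'a \<Rightarrow> nat"
    have "(SUP x. ennreal (exp (real n * \<omega> (norm x)) * norm (mpartial \<alpha> f x))) * ennreal (young_factor \<omega> m (morder \<alpha>))
        \<le> ennreal (C * fact (morder \<alpha>)) * ennreal (young_factor \<omega> m (morder \<alpha>))"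
      using C by (intro mult_right_mono SUP_least ennreal_leI) auto
    also have "\<dots> = ennreal (C * (young_factor \<omega> m (morder \<alpha>) * fact (morder \<alpha>)))"
      using C(1) by (simp add: mult_ac flip: ennreal_mult)
    also have "\<dots> \<le> ennreal (C * Y)" using C(1) Y(2) by (intro ennreal_leI mult_left_mono)
    finally show "(SUP x. ennreal (exp (real n * \<omega> (norm x)) * norm (mpartial \<alpha> f x))) *
      ennreal (young_factor \<omega> m (morder \<alpha>)) \<le> ennreal (C * Y)" .
  qed
  then show ?thesis by (rule le_less_trans) simp
qed

text \<open>Since \<omega> is nonnegative,
  \<open>exp (- n * \<omega>) \<le> 1 \<le> exp (n' * \<omega>)\<close> for any two indices.\<close>

lemma O_norm_le_S_norm:
  assumes w: "nonquasianalytic_weight \<omega>"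
  shows "O_norm \<omega> m n f \<le> S_norm \<omega> m n' f"
  unfolding O_norm_def S_norm_def
proof (rule SUP_least, rule SUP_least)
  fix \<alpha> :: "'a \<Rightarrow> nat" and x :: "real^'a"
  have "- (real n * \<omega> (norm x)) \<le> real n' * \<omega> (norm x)"
    by (rule order_trans[of _ 0]) (use weight_norm_nonneg[OF w, of x] in auto)
  then have "norm (mpartial \<alpha> f x) * exp (- (real n * \<omega> (norm x)))
      \<le> exp (real n' * \<omega> (norm x)) * norm (mpartial \<alpha> f x)"
    by (simp add: mult.commute[of "norm _"] mult_right_mono)
  then have "ennreal (norm (mpartial \<alpha> f x) * exp (- (real n * \<omega> (norm x)))) * ennreal (young_factor \<omega> m (morder \<alpha>))
      \<le> (SUP x. ennreal (exp (real n' * \<omega> (norm x)) * norm (mpartial \<alpha> f x))) * ennreal (young_factor \<omega> m (morder \<alpha>))"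
    by (intro mult_right_mono SUP_upper2[of x] ennreal_leI) auto
  then show "ennreal (norm (mpartial \<alpha> f x) * exp (- (real n * \<omega> (norm x))) * young_factor \<omega> m (morder \<alpha>))
      \<le> (SUP \<alpha>. (SUP x. ennreal (exp (real n' * \<omega> (norm x)) * norm (mpartial \<alpha> f x)))
        * ennreal (young_factor \<omega> m (morder \<alpha>)))"
    by (intro SUP_upper2[of \<alpha>]) (simp_all add: ennreal_mult)
qed

section \<open>Linear structure of the spaces and membership of the Gaussians\<close>

lemma S_set_lincomb:
  assumes "f \<in> S_set \<omega>" "g \<in> S_set \<omega>"
  shows "(\<lambda>x. a * f x + b * g x) \<in> S_set \<omega>"
proof -
  have i: "integrable lborel f" "integrable lborel g" and s: "smooth f" "smooth g"
    "smooth (fourier f)" "smooth (fourier g)"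
    using assms unfolding S_set_def by auto
  have meas: "(\<lambda>x. cis (- (x \<bullet> \<xi>))) \<in> borel_measurable borel" for \<xi> :: "real^'a"
    by (simp add: cis_conv_exp)
  \<comment> \<open>Multiplication by a unimodular factor keeps integrability, so the Fourier
    integral may be split.\<close>
  have fi: "integrable lborel (\<lambda>x. cis (- (x \<bullet> \<xi>)) * h x)" if "integrable lborel h" for h and \<xi> :: "real^'a"
    by (rule Bochner_Integration.integrable_bound[OF that])
       (use meas that in \<open>auto simp: norm_mult intro!: borel_measurable_times\<close>)
  have F: "fourier (\<lambda>x. a * f x + b * g x) = (\<lambda>\<xi>. a * fourier f \<xi> + b * fourier g \<xi>)"
  proof
    fix \<xi>
    have "fourier (\<lambda>x. a * f x + b * g x) \<xi> =
        (\<integral>x. a * (cis (- (x \<bullet> \<xi>)) * f x) + b * (cis (- (x \<bullet> \<xi>)) * g x) \<partial>lborel)"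
      unfolding fourier_def by (intro Bochner_Integration.integral_cong) (auto simp: algebra_simps)
    also have "\<dots> = a * fourier f \<xi> + b * fourier g \<xi>"
      unfolding fourier_def using fi[OF i(1)] fi[OF i(2)] by simp
    finally show "fourier (\<lambda>x. a * f x + b * g x) \<xi> = a * fourier f \<xi> + b * fourier g \<xi>" .
  qed
  have b: "bounded (range (\<lambda>x. e x *\<^sub>R (a * p x + b * q x)))"
    if pq: "bounded (range (\<lambda>x. e x *\<^sub>R p x))" "bounded (range (\<lambda>x. e x *\<^sub>R q x))"
    for e :: "real^'a \<Rightarrow> real" and p q
  proof -
    obtain P Q where PQ: "\<And>x. norm (e x *\<^sub>R p x) \<le> P" "\<And>x. norm (e x *\<^sub>R q x) \<le> Q"
      using pq unfolding bounded_iff by auto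
    have "norm (e x *\<^sub>R (a * p x + b * q x)) \<le> norm a * P + norm b * Q" for x
    proof -
      have "e x *\<^sub>R (a * p x + b * q x) = a * (e x *\<^sub>R p x) + b * (e x *\<^sub>R q x)"
        by (simp add: algebra_simps)
      also have "norm \<dots> \<le> norm a * norm (e x *\<^sub>R p x) + norm b * norm (e x *\<^sub>R q x)"
        by (metis norm_triangle_ineq norm_mult)
      also have "\<dots> \<le> norm a * P + norm b * Q"
        using PQ by (intro add_mono mult_left_mono) auto
      finally show ?thesis .
    qed
    then show ?thesis unfolding bounded_iff by auto
  qed
  show ?thesis
    unfolding S_set_def mem_Collect_eq F mpartial_lincomb[OF s(1,2)] mpartial_lincomb[OF s(3,4)]
  proof (intro conjI allI impI)
    show "integrable lborel (\<lambda>x. a * f x + b * g x)" using i by simp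
    fix l :: real and \<alpha> :: "'a \<Rightarrow> nat" assume "l > 0"
    then have bd: "bounded (range (\<lambda>x. exp (l * \<omega> (norm x)) *\<^sub>R mpartial \<alpha> h x))"
      "bounded (range (\<lambda>x. exp (l * \<omega> (norm x)) *\<^sub>R mpartial \<alpha> (fourier h) x))" if "h \<in> S_set \<omega>" for h
      using that unfolding S_set_def by blast+
    show "bounded (range (\<lambda>x. exp (l * \<omega> (norm x)) *\<^sub>R (a * mpartial \<alpha> f x + b * mpartial \<alpha> g x)))"
      by (rule b[OF bd(1)[OF assms(1)] bd(1)[OF assms(2)]])
    show "bounded (range (\<lambda>x. exp (l * \<omega> (norm x)) *\<^sub>R (a * mpartial \<alpha> (fourier f) x + b * mpartial \<alpha> (fourier g) x)))"
      by (rule b[OF bd(2)[OF assms(1)] bd(2)[OF assms(2)]])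
  qed (use s in \<open>simp_all add: smooth_lincomb\<close>)
qed

lemma fourier_0: "fourier (\<lambda>x. 0) = (\<lambda>x. 0)"
  by (simp add: fourier_def)

lemma zero_in_S_set [simp]: "(\<lambda>x. 0) \<in> S_set \<omega>"
  by (simp add: S_set_def fourier_0)

lemma gauss_in_S_set:
  assumes w: "nonquasianalytic_weight \<omega>"
  shows "gauss z \<in> S_set \<omega>"
proof -
  have b: "bounded (range (\<lambda>x. exp (l * \<omega> (norm x)) *\<^sub>R mpartial \<alpha> f x))"
    if f: "rapid f" and l: "l > 0" for f l \<alpha>
  proof -
    obtain C where "\<And>\<alpha> x. exp (l * \<omega> (norm x)) * norm (mpartial \<alpha> f x) \<le> C * fact (morder \<alpha>)"
      using rapid_weighted_bound[OF w f less_imp_le[OF l]] by metis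
    then show ?thesis unfolding bounded_iff by (intro exI[of _ "C * fact (morder \<alpha>)"]) auto
  qed
  have "rapid (fourier (gauss z))" unfolding fourier_gauss by (rule rapid_tensor_gexp)
  then show ?thesis
    using b[of "gauss z"] b[of "fourier (gauss z)"] rapid_gauss[of z] integrable_gauss[of z]
    unfolding S_set_def by (auto simp: rapid_def)
qed

section \<open>Bounded sets\<close>

lemma S_set_smooth: "f \<in> S_set \<omega> \<Longrightarrow> smooth f"
  by (simp add: S_set_def)

lemma topspace_S_space [simp]: "topspace (S_space \<omega>) = S_set \<omega>"
  by (simp add: S_space_def)

lemma smooth_OC: "f \<in> topspace (OC_space \<omega>) \<Longrightarrow> smooth f"
  by (auto simp: topspace_OC_space O_set_def)

lemma O_norm_antimono:
  assumes w: "nonquasianalytic_weight \<omega>" and "n \<le> n'"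
  shows "O_norm \<omega> m n' f \<le> O_norm \<omega> m n f"
  unfolding O_norm_def
proof (intro SUP_subset_mono order_refl ennreal_leI mult_right_mono mult_left_mono)
  fix x :: "real^'a"
  show "exp (- (real n' * \<omega> (norm x))) \<le> exp (- (real n * \<omega> (norm x)))"
    using \<open>n \<le> n'\<close> weight_norm_nonneg[OF w, of x] by (auto intro!: mult_right_mono)
qed auto

lemma OC_lincomb:
  assumes w: "nonquasianalytic_weight \<omega>"
    and "f \<in> topspace (OC_space \<omega>)" "g \<in> topspace (OC_space \<omega>)"
  shows "(\<lambda>x. a * f x + b * g x) \<in> topspace (OC_space \<omega>)"
proof -
  obtain n n' where n: "n \<ge> 1" "n' \<ge> 1" "\<And>m. m \<ge> 1 \<Longrightarrow> O_norm \<omega> m n f < \<infinity>" "\<And>m. m \<ge> 1 \<Longrightarrow> O_norm \<omega> m n' g < \<infinity>"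
    using assms(2,3) by (auto simp: topspace_OC_space O_set_def)
  have s: "smooth f" "smooth g" using assms(2,3) by (auto intro: smooth_OC)
  \<comment> \<open>Both functions lie in the step with the larger index, as a larger weight shrinks
    the norm.\<close>
  have "O_norm \<omega> m (max n n') (\<lambda>x. a * f x + b * g x) < \<infinity>" if "m \<ge> 1" for m
  proof -
    have "O_norm \<omega> m (max n n') (\<lambda>x. a * f x + b * g x) \<le>
        ennreal (norm a) * O_norm \<omega> m (max n n') f + ennreal (norm b) * O_norm \<omega> m (max n n') g"
      by (rule O_norm_lincomb[OF s])
    also have "\<dots> \<le> ennreal (norm a) * O_norm \<omega> m n f + ennreal (norm b) * O_norm \<omega> m n' g"
      by (intro add_mono mult_left_mono O_norm_antimono[OF w]) auto
    also have "\<dots> < \<infinity>"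
      using n(3)[OF that] n(4)[OF that] by (simp add: ennreal_mult_less_top)
    finally show ?thesis .
  qed
  then show ?thesis
    using n(1) smooth_lincomb[OF s]
    by (auto simp: topspace_OC_space O_set_def intro!: bexI[of _ "max n n'"])
qed

lemma zero_in_OC [simp]: "(\<lambda>x. 0) \<in> topspace (OC_space \<omega>)"
  by (auto simp: topspace_OC_space O_set_def)

lemma gauss_in_OC:
  assumes w: "nonquasianalytic_weight \<omega>"
  shows "gauss z \<in> topspace (OC_space \<omega>)"
proof -
  have "O_norm \<omega> m 1 (gauss z) < \<infinity>" if "m \<ge> 1" for m
    using O_norm_le_S_norm[OF w] S_norm_rapid_finite[OF w rapid_gauss that] by (rule le_less_trans)
  then show ?thesis
    using rapid_gauss[of z] by (auto simp: topspace_OC_space O_set_def rapid_def intro!: bexI[of _ 1])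
qed

text \<open>Continuous on every step of the inductive limit, because only the finitely many terms
  \<open>k < n\<close> are not controlled by the weight \<open>exp (n \<omega>)\<close>.\<close>

definition eval_seminorm :: "(real \<Rightarrow> real) \<Rightarrow> (nat \<Rightarrow> real^'n) \<Rightarrow> (real^'n \<Rightarrow> complex) \<Rightarrow> ennreal" where
  "eval_seminorm \<omega> z g = (SUP k. ennreal (norm (g (z k)) * exp (- (real k * \<omega> (norm (z k))))))"

lemma le_eval_seminorm:
  "ennreal (norm (g (z k)) * exp (- (real k * \<omega> (norm (z k))))) \<le> eval_seminorm \<omega> z g"
  unfolding eval_seminorm_def by (rule SUP_upper) simp

lemma eval_seminorm_0 [simp]: "eval_seminorm \<omega> z (\<lambda>x. 0) = 0"
  by (simp add: eval_seminorm_def)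

lemma eval_seminorm_add:
  "eval_seminorm \<omega> z (\<lambda>x. f x + g x) \<le> eval_seminorm \<omega> z f + eval_seminorm \<omega> z g"
  unfolding eval_seminorm_def[of _ _ "\<lambda>x. f x + g x"]
proof (rule SUP_least)
  fix k
  let ?e = "exp (- (real k * \<omega> (norm (z k))))"
  have "norm (f (z k) + g (z k)) * ?e \<le> norm (f (z k)) * ?e + norm (g (z k)) * ?e"
    unfolding distrib_right[symmetric] by (intro mult_right_mono norm_triangle_ineq) auto
  then have "ennreal (norm (f (z k) + g (z k)) * ?e) \<le> ennreal (norm (f (z k)) * ?e) + ennreal (norm (g (z k)) * ?e)"
    by (simp add: ennreal_leI flip: ennreal_plus)
  also have "\<dots> \<le> eval_seminorm \<omega> z f + eval_seminorm \<omega> z g"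
    by (intro add_mono le_eval_seminorm)
  finally show "ennreal (norm (f (z k) + g (z k)) * ?e) \<le> eval_seminorm \<omega> z f + eval_seminorm \<omega> z g" .
qed

lemma eval_seminorm_mult: "eval_seminorm \<omega> z (\<lambda>x. c * f x) = ennreal (norm c) * eval_seminorm \<omega> z f"
  by (simp add: eval_seminorm_def SUP_mult_left_ennreal norm_mult ennreal_mult mult.assoc)

lemma eval_seminorm_le_O_norm:
  fixes z :: "nat \<Rightarrow> real^'n::finite"
  assumes w: "nonquasianalytic_weight \<omega>"
  obtains C where "C \<ge> 0" "\<And>h. eval_seminorm \<omega> z h \<le> ennreal C * O_norm \<omega> 1 n h"
proof -
  \<comment> \<open>The summand 1 serves all \<open>k \<ge> n\<close>, the sum serves the finitely
    many \<open>k < n\<close>.\<close>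
  define C where "C = 1 + (\<Sum>k<n. exp (real n * \<omega> (norm (z k))))"
  have C: "C \<ge> 1" by (simp add: C_def sum_nonneg)
  have "ennreal (norm (h (z k)) * exp (- (real k * \<omega> (norm (z k))))) \<le> ennreal C * O_norm \<omega> 1 n h" for k h
  proof -
    have 1: "exp (- (real k * \<omega> (norm (z k)))) \<le> C * exp (- (real n * \<omega> (norm (z k))))"
    proof (cases "k < n")
      case True
      then have "exp (real n * \<omega> (norm (z k))) \<le> (\<Sum>k<n. exp (real n * \<omega> (norm (z k))))"
        by (intro member_le_sum) auto
      then have "exp (real n * \<omega> (norm (z k))) \<le> C" by (simp add: C_def)
      then have "1 \<le> C * exp (- (real n * \<omega> (norm (z k))))" by (simp add: exp_minus field_simps)
      moreover have "exp (- (real k * \<omega> (norm (z k)))) \<le> 1" using weight_norm_nonneg[OF w, of "z k"] by simp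
      ultimately show ?thesis by linarith
    next
      case False
      then have "exp (- (real k * \<omega> (norm (z k)))) \<le> 1 * exp (- (real n * \<omega> (norm (z k))))"
        using weight_norm_nonneg[OF w, of "z k"] by (auto intro!: mult_right_mono)
      also have "\<dots> \<le> C * exp (- (real n * \<omega> (norm (z k))))" using C by (intro mult_right_mono) auto
      finally show ?thesis .
    qed
    have "norm (h (z k)) * exp (- (real k * \<omega> (norm (z k)))) \<le> C * (norm (h (z k)) * exp (- (real n * \<omega> (norm (z k)))))"
      using mult_left_mono[OF 1 norm_ge_zero[of "h (z k)"]] by (simp add: mult_ac)
    then have "ennreal (norm (h (z k)) * exp (- (real k * \<omega> (norm (z k))))) \<le>
        ennreal C * ennreal (norm (h (z k)) * exp (- (real n * \<omega> (norm (z k)))))"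
      using C by (simp add: ennreal_leI flip: ennreal_mult)
    also have "\<dots> \<le> ennreal C * O_norm \<omega> 1 n h" by (intro mult_left_mono le_O_norm[OF w]) auto
    finally show ?thesis .
  qed
  then show ?thesis using C by (intro that[of C]) (auto simp: eval_seminorm_def intro: SUP_least)
qed

definition OC_seminorms :: "(real \<Rightarrow> real) \<Rightarrow> ((real^'n::finite \<Rightarrow> complex) \<Rightarrow> ennreal) set" where
  "OC_seminorms \<omega> = {p. seminorm_on (topspace (OC_space \<omega>)) p \<and>
     (\<forall>n\<in>{1..}. continuous_map (OC_step \<omega> n) euclidean p)}"

text \<open>Displays the inductive limit as a seminorm topology, so that the general lemmas on those
  apply to it.\<close>

lemma OC_space_eq: "OC_space \<omega> = seminorm_topology (topspace (OC_space \<omega>)) (OC_seminorms \<omega>)"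
proof -
  have topspace: "(\<Union>n\<in>{1..}. topspace (OC_step \<omega> n)) = topspace (OC_space \<omega>)"
    by (simp add: OC_space_def lc_inductive_limit_def Let_def)
  have "OC_space \<omega> = seminorm_topology (\<Union>n\<in>{1..}. topspace (OC_step \<omega> n))
    {p. seminorm_on (\<Union>n\<in>{1..}. topspace (OC_step \<omega> n)) p \<and>
      (\<forall>n\<in>{1..}. continuous_map (OC_step \<omega> n) euclidean p)}"
    by (simp only: OC_space_def lc_inductive_limit_def Let_def)
  then show ?thesis unfolding topspace OC_seminorms_def .
qed

lemma eval_seminorm_in_OC_seminorms:
  fixes z :: "nat \<Rightarrow> real^'n::finite"
  assumes w: "nonquasianalytic_weight \<omega>"
  shows "eval_seminorm \<omega> z \<in> OC_seminorms \<omega>"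
proof -
  have fin: "eval_seminorm \<omega> z f < \<infinity>" if f: "O_norm \<omega> 1 n f < \<infinity>"
    for f :: "real^'n \<Rightarrow> complex" and n
  proof -
    obtain C where "C \<ge> 0" "eval_seminorm \<omega> z f \<le> ennreal C * O_norm \<omega> 1 n f"
      using eval_seminorm_le_O_norm[OF w, of z n] by metis
    moreover have "ennreal C * O_norm \<omega> 1 n f < \<infinity>"
      using f by (simp add: ennreal_mult_less_top)
    ultimately show ?thesis by (meson le_less_trans)
  qed
  have "continuous_map (OC_step \<omega> n) euclidean (eval_seminorm \<omega> z)" for n
  proof -
    obtain C where C: "C \<ge> 0" "\<And>h. eval_seminorm \<omega> z h \<le> ennreal C * O_norm \<omega> 1 n h"
      using eval_seminorm_le_O_norm[OF w, of z n] by metis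
    have "O_norm \<omega> 1 n \<in> {O_norm \<omega> m n |m. m \<ge> 1}" by blast
    then show ?thesis
      unfolding OC_step_def
    proof (rule continuous_map_seminorm[OF _ C(1)])
      fix f :: "real^'n \<Rightarrow> complex" assume "f \<in> (\<Inter>m\<in>{1..}. O_set \<omega> m n)"
      then show "eval_seminorm \<omega> z f < \<infinity>" by (intro fin[of n]) (auto simp: O_set_def)
    next
      fix f g :: "real^'n \<Rightarrow> complex"
      show "eval_seminorm \<omega> z (\<lambda>x. f x - g x) = eval_seminorm \<omega> z (\<lambda>x. g x - f x)"
        unfolding eval_seminorm_def by (simp add: norm_minus_commute)
    qed (use C(2) eval_seminorm_add in auto)
  qed
  moreover have "eval_seminorm \<omega> z f < \<infinity>" if "f \<in> topspace (OC_space \<omega>)" for f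
    using that fin by (auto simp: topspace_OC_space O_set_def)
  ultimately show ?thesis
    unfolding OC_seminorms_def seminorm_on_def by (auto simp: eval_seminorm_add eval_seminorm_mult)
qed

text \<open>One index serves as constant and as exponent, so the negation directly yields the
  sequences \<open>G\<close> and \<open>z\<close>. On \<open>z\<close> the seminorm
  \<open>eval_seminorm\<close> contradicts absorption of \<open>B\<close>.\<close>

lemma tvs_bounded_OC:
  fixes B :: "(real^'n::finite \<Rightarrow> complex) set"
  assumes w: "nonquasianalytic_weight \<omega>" and B: "tvs_bounded (OC_space \<omega>) B"
  shows "\<exists>n::nat. \<forall>g\<in>B. \<forall>x. norm (g x) \<le> real n * exp (real n * \<omega> (norm x))"
proof (rule ccontr)
  have B': "tvs_bounded (seminorm_topology (topspace (OC_space \<omega>)) (OC_seminorms \<omega>)) B"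
    by (subst OC_space_eq[symmetric]) (rule B)
  assume "\<not> ?thesis"
  then have "\<forall>n. \<exists>g x. g \<in> B \<and> norm (g x) > real n * exp (real n * \<omega> (norm x))"
    by (meson not_le)
  then obtain G z where G: "\<And>n. G n \<in> B" "\<And>n. norm (G n (z n)) > real n * exp (real n * \<omega> (norm (z n)))"
    by metis
  obtain c where c: "c > 0"
    "\<And>g. g \<in> B \<Longrightarrow> \<exists>u. eval_seminorm \<omega> z u < 1 \<and> g = (\<lambda>x. complex_of_real c * u x)"
    by (rule tvs_bounded_seminorm[OF B' eval_seminorm_in_OC_seminorms[OF w, of z] zero_in_OC eval_seminorm_0]) blast
  obtain n :: nat where n: "real n \<ge> c" using real_arch_simple by blast
  obtain u where u: "eval_seminorm \<omega> z u < 1" "G n = (\<lambda>x. complex_of_real c * u x)"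
    using c(2)[OF G(1)[of n]] by blast
  have "ennreal (norm (u (z n)) * exp (- (real n * \<omega> (norm (z n))))) < ennreal 1"
    using le_less_trans[OF le_eval_seminorm u(1), of n] by simp
  then have "norm (u (z n)) * exp (- (real n * \<omega> (norm (z n)))) < 1"
    by (subst (asm) ennreal_less_iff) auto
  then have "norm (u (z n)) \<le> exp (real n * \<omega> (norm (z n)))"
    by (simp add: exp_minus field_simps)
  then have "c * norm (u (z n)) \<le> real n * exp (real n * \<omega> (norm (z n)))"
    using n c(1) by (intro mult_mono) auto
  then show False using G(2)[of n] u(2) c(1) by (simp add: norm_mult)
qed

lemma tvs_bounded_S:
  fixes B :: "(real^'n::finite \<Rightarrow> complex) set"
  assumes w: "nonquasianalytic_weight \<omega>" and B: "tvs_bounded (S_space \<omega>) B" and "n \<ge> 1"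
  obtains C where "C > 0" "\<And>g x. g \<in> B \<Longrightarrow> exp (real n * \<omega> (norm x)) * norm (g x) \<le> C"
proof -
  have "S_norm \<omega> 1 n \<in> {S_norm \<omega> m n |m n. m \<ge> 1 \<and> n \<ge> 1}" using \<open>n \<ge> 1\<close> by blast
  note bounded = tvs_bounded_seminorm[OF B[unfolded S_space_def] this zero_in_S_set S_norm_0]
  obtain c where c: "c > 0"
    "\<And>g. g \<in> B \<Longrightarrow> \<exists>u. S_norm \<omega> 1 n u < 1 \<and> g = (\<lambda>x. complex_of_real c * u x)"
    by (rule bounded) blast
  have "exp (real n * \<omega> (norm x)) * norm (g x) \<le> c" if g: "g \<in> B" for g x
  proof -
    obtain u where u: "S_norm \<omega> 1 n u < 1" "g = (\<lambda>x. complex_of_real c * u x)"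
      using c(2)[OF g] by blast
    have "ennreal (exp (real n * \<omega> (norm x)) * norm (u x)) < ennreal 1"
      using le_less_trans[OF le_S_norm[OF w] u(1)] by simp
    then have "exp (real n * \<omega> (norm x)) * norm (u x) < 1"
      by (subst (asm) ennreal_less_iff) auto
    then have "c * (exp (real n * \<omega> (norm x)) * norm (u x)) \<le> c * 1"
      using c(1) by (intro mult_left_mono) auto
    then show ?thesis using u(2) c(1) by (simp add: norm_mult mult_ac)
  qed
  then show ?thesis using that c(1) by blast
qed

text \<open>A neighbourhood of the origin involves finitely many norms, each finite at the Gaussian,
  so a small enough multiple enters it.\<close>

lemma tvs_bounded_gauss:
  assumes w: "nonquasianalytic_weight \<omega>"
  shows "tvs_bounded (S_space \<omega>) {gauss z :: real^'n::finite \<Rightarrow> complex}"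
  unfolding tvs_bounded_def
proof (intro conjI allI impI)
  let ?f = "gauss z :: real^'n \<Rightarrow> complex"
  show "{?f} \<subseteq> topspace (S_space \<omega>)" using gauss_in_S_set[OF w] by simp
  fix U assume "openin (S_space \<omega>) U \<and> (\<lambda>x::real^'n. 0 :: complex) \<in> U"
  then have U: "openin (seminorm_topology (S_set \<omega>) {S_norm \<omega> m n |m n. m \<ge> 1 \<and> n \<ge> 1}) U"
    "(\<lambda>x::real^'n. 0 :: complex) \<in> U"
    by (simp_all add: S_space_def)
  have tri: "p (\<lambda>x. g x - h x) \<le> p g + p (\<lambda>x. 0 - h x)"
    if p: "p \<in> {S_norm \<omega> m n |m n. m \<ge> 1 \<and> n \<ge> 1}" and gh: "g \<in> S_set \<omega>" "h \<in> S_set \<omega>" for p and g h :: "real^'n \<Rightarrow> complex"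
  proof -
    obtain m n where p: "p = S_norm \<omega> m n" using p by blast
    have s: "smooth g" "smooth h" using gh by (auto intro: S_set_smooth)
    have "smooth (\<lambda>x. 0 - h x)" using smooth_lincomb[OF s(2) s(2), of 0 "-1"] by simp
    from S_norm_lincomb[OF s(1) this, of \<omega> m n 1 1] show ?thesis by (simp add: p)
  qed
  obtain Q \<delta> where Q: "finite Q" "Q \<subseteq> {S_norm \<omega> m n |m n. m \<ge> 1 \<and> n \<ge> 1}" "\<delta> > 0"
    "\<And>g :: real^'n \<Rightarrow> complex. g \<in> S_set \<omega> \<Longrightarrow> (\<And>p. p \<in> Q \<Longrightarrow> p g < ennreal \<delta>) \<Longrightarrow> g \<in> U"
    by (rule seminorm_topology_nhd[OF U]) (rule tri, assumption+, blast)
  have fin: "p ?f < \<infinity>" if "p \<in> Q" for p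
    using that Q(2) S_norm_rapid_finite[OF w rapid_gauss] by auto
  then have "(\<Sum>p\<in>Q. p ?f) < \<infinity>" using Q(1) by (simp add: less_top)
  then obtain r where r: "(\<Sum>p\<in>Q. p ?f) = ennreal r" "r \<ge> 0" by (cases "\<Sum>p\<in>Q. p ?f") auto
  \<comment> \<open>Adding 1 keeps \<open>c\<close> positive when \<open>r = 0\<close> and makes
    \<open>r / c < \<delta>\<close> strict.\<close>
  define c where "c = (r + 1) / \<delta>"
  have c: "c > 0" "r / c < \<delta>" using r Q(3) by (auto simp: c_def field_simps)
  \<comment> \<open>The vanishing second summand puts the multiple into the shape of the
    linear-combination lemmas.\<close>
  let ?g = "\<lambda>x. complex_of_real (1 / c) * ?f x + 0 * ?f x"
  have "?g \<in> U"
  proof (rule Q(4))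
    show "?g \<in> S_set \<omega>" by (intro S_set_lincomb gauss_in_S_set[OF w])
    fix p assume p: "p \<in> Q"
    then obtain m n where mn: "p = S_norm \<omega> m n" using Q(2) by blast
    have "smooth ?f" using gauss_in_S_set[OF w] by (rule S_set_smooth)
    then have "p ?g \<le> ennreal (norm (complex_of_real (1 / c))) * p ?f + ennreal (norm (0 :: complex)) * p ?f"
      unfolding mn by (rule S_norm_lincomb) (rule \<open>smooth ?f\<close>)
    also have "\<dots> = ennreal (1 / c) * p ?f" using c(1) by (simp add: norm_divide)
    also have "p ?f \<le> ennreal r"
      unfolding r(1)[symmetric] using p Q(1) by (intro member_le_sum) auto
    then have "ennreal (1 / c) * p ?f \<le> ennreal (1 / c) * ennreal r" by (rule mult_left_mono) simp
    also have "\<dots> = ennreal (r / c)" using c(1) r(2) by (simp flip: ennreal_mult)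
    also have "\<dots> < ennreal \<delta>" using c(2) Q(3) by (intro ennreal_lessI) auto
    finally show "p ?g < ennreal \<delta>" .
  qed
  moreover have "?f = (\<lambda>x. complex_of_real c * ?g x)" using c(1) by auto
  ultimately have "?f \<in> (\<lambda>f x. complex_of_real c * f x) ` U" by (intro image_eqI)
  then show "\<exists>c::real. c > 0 \<and> {?f} \<subseteq> (\<lambda>f x. complex_of_real c * f x) ` U"
    using c(1) by (intro exI[of _ c]) simp
qed

section \<open>Point evaluations\<close>

text \<open>A multiple of the point mass, restricted to \<open>E\<close> because
  \<open>dual_space\<close> demands extensional functionals. With coefficient 0 it is the zero of
  the dual.\<close>

definition delta :: "('x \<Rightarrow> complex) set \<Rightarrow> 'x \<Rightarrow> complex \<Rightarrow> ('x \<Rightarrow> complex) \<Rightarrow> complex" where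
  "delta E x a = (\<lambda>f\<in>E. a * f x)"

lemma delta_in_dual_space:
  fixes P :: "(('x \<Rightarrow> complex) \<Rightarrow> ennreal) set"
  assumes X: "X = seminorm_topology E P"
    and lin: "\<And>f g a b. f \<in> E \<Longrightarrow> g \<in> E \<Longrightarrow> (\<lambda>x. a * f x + b * g x) \<in> E"
    and q: "q \<in> P" "q (\<lambda>x. 0) = 0" "\<And>f. ennreal (norm (f x)) \<le> q f"
  shows "delta E x a \<in> dual_space X"
proof -
  have "(\<lambda>x. f x + g x) \<in> E" if "f \<in> E" "g \<in> E" for f g
    using lin[of f g 1 1] that by simp
  moreover have "(\<lambda>x. c * f x) \<in> E" if "f \<in> E" for f c
    using lin[of f f c 0] that by simp
  moreover have "continuous_map X euclidean (delta E x a)"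
    unfolding X
  proof (rule continuous_map_seminorm_topology[OF q(1) norm_ge_zero[of a] q(2)])
    fix f g assume "f \<in> E" "g \<in> E"
    then have "dist (delta E x a g) (delta E x a f) = norm a * norm (g x - f x)"
      by (simp add: delta_def dist_norm norm_mult flip: right_diff_distrib)
    then show "ennreal (dist (delta E x a g) (delta E x a f)) \<le> ennreal (norm a) * q (\<lambda>x. g x - f x)"
      using q(3)[of "\<lambda>x. g x - f x"] by (simp add: ennreal_mult mult_left_mono)
  qed
  ultimately show ?thesis
    unfolding dual_space_def by (simp add: X delta_def algebra_simps)
qed

lemma delta_in_dual_S:
  assumes w: "nonquasianalytic_weight \<omega>"
  shows "delta (S_set \<omega>) x a \<in> dual_space (S_space \<omega>)"
proof (rule delta_in_dual_space[OF S_space_def])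
  show "S_norm \<omega> 1 1 \<in> {S_norm \<omega> m n |m n. m \<ge> 1 \<and> n \<ge> 1}" by blast
  fix f :: "real^'a \<Rightarrow> complex"
  have "1 * norm (f x) \<le> exp (real 1 * \<omega> (norm x)) * norm (f x)"
    using weight_norm_nonneg[OF w, of x] by (intro mult_right_mono) auto
  then have "ennreal (norm (f x)) \<le> ennreal (exp (real 1 * \<omega> (norm x)) * norm (f x))"
    by (intro ennreal_leI) simp
  also have "\<dots> \<le> S_norm \<omega> 1 1 f" by (rule le_S_norm[OF w])
  finally show "ennreal (norm (f x)) \<le> S_norm \<omega> 1 1 f" .
qed (auto intro: S_set_lincomb)

lemma delta_in_dual_OC:
  assumes w: "nonquasianalytic_weight \<omega>"
  shows "delta (topspace (OC_space \<omega>)) x a \<in> dual_space (OC_space \<omega>)"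
proof (rule delta_in_dual_space[OF OC_space_eq])
  \<comment> \<open>For a constant sequence, the term \<open>k = 0\<close> is the unweighted value
    at \<open>x\<close>.\<close>
  show "eval_seminorm \<omega> (\<lambda>_. x) \<in> OC_seminorms \<omega>" by (rule eval_seminorm_in_OC_seminorms[OF w])
  show "ennreal (norm (f x)) \<le> eval_seminorm \<omega> (\<lambda>_. x) f" for f
    using le_eval_seminorm[of f "\<lambda>_. x" 0 \<omega>] by simp
qed (auto intro: OC_lincomb[OF w])

text \<open>The reflection in \<open>reflect_functional\<close> undoes the one in
  \<open>conv_fun\<close>, so convolving with a point mass at \<open>z\<close> evaluates
  \<open>gauss 0 (x + y)\<close> at \<open>y = z\<close>.\<close>

lemma convolution_delta:
  assumes w: "nonquasianalytic_weight \<omega>"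
  shows "convolution \<omega> (delta (topspace (OC_space \<omega>)) z a) (delta (S_set \<omega>) x b) (gauss 0) =
    b * (a * gauss z x)"
proof -
  have "conv_fun (reflect_functional (delta (topspace (OC_space \<omega>)) z a)) (gauss 0) x = a * gauss z x" for x
  proof -
    have "gauss 0 (x + y) = gauss x y" for y
      using gauss_translate[of 0 y x] by (simp add: add.commute)
    moreover have "gauss x z = gauss z x"
      using gauss_translate[of 0 x z] gauss_translate[of 0 z x] by (simp add: add.commute)
    moreover have "(\<lambda>y. gauss x y) \<in> topspace (OC_space \<omega>)" using gauss_in_OC[OF w, of x] by simp
    ultimately show ?thesis
      by (simp add: conv_fun_def reflect_functional_def reflect_def delta_def)
  qed
  then have eq: "conv_fun (reflect_functional (delta (topspace (OC_space \<omega>)) z a)) (gauss 0) = (\<lambda>x. a * gauss z x)"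
    by blast
  have "(\<lambda>x. a * gauss z x) \<in> S_set \<omega>"
    using S_set_lincomb[OF gauss_in_S_set[OF w, of z] gauss_in_S_set[OF w, of z], of a 0] by simp
  then show ?thesis
    unfolding convolution_def by (simp add: eq gauss_in_S_set[OF w]) (simp add: delta_def)
qed

text \<open>Properties that hold eventually in the index hold simultaneously for finitely many
  sets.\<close>

lemma uniform_index_finite:
  assumes "finite \<B>" "\<And>B. B \<in> \<B> \<Longrightarrow> \<exists>n::nat. \<forall>m\<ge>n. Q B m"
  shows "\<exists>n. \<forall>B\<in>\<B>. Q B n"
proof -
  have "\<forall>B\<in>\<B>. \<forall>\<^sub>F n in sequentially. Q B n"
    using assms(2) by (simp add: eventually_sequentially)
  then have "\<forall>\<^sub>F n in sequentially. \<forall>B\<in>\<B>. Q B n"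
    using assms(1) by (simp add: eventually_ball_finite)
  then show ?thesis by (auto simp: eventually_sequentially)
qed

section \<open>Refutation of joint continuity\<close>

theorem corollary4p11:
  fixes \<omega> :: "real \<Rightarrow> real"
  assumes "nonquasianalytic_weight \<omega>"
    and "(\<lambda>t. ln (1 + t)) \<in> o[at_top](\<omega>)"
  shows "\<not> continuous_map
      (prod_topology (strong_dual (OC_space \<omega> :: (real^'n \<Rightarrow> complex) topology))
                     (strong_dual (S_space \<omega> :: (real^'n \<Rightarrow> complex) topology)))
      (strong_dual (S_space \<omega> :: (real^'n \<Rightarrow> complex) topology))
      (\<lambda>(T, S). convolution \<omega> T S)"
proof
  let ?X = "OC_space \<omega> :: (real^'n \<Rightarrow> complex) topology"
  let ?Y = "S_space \<omega> :: (real^'n \<Rightarrow> complex) topology"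
  let ?f = "gauss 0 :: real^'n \<Rightarrow> complex"
  let ?T = "\<lambda>z a. delta (topspace ?X) z a" and ?S = "\<lambda>z a. delta (S_set \<omega>) (z :: real^'n) a"
  assume cont: "continuous_map (prod_topology (strong_dual ?X) (strong_dual ?Y)) (strong_dual ?Y)
    (\<lambda>(T, S). convolution \<omega> T S)"
  note w = assms(1)
  define W where "W = {R \<in> dual_space ?Y. norm (R ?f) < 1}"
  have W: "openin (strong_dual ?Y) W"
    unfolding W_def
    by (rule openin_strong_dual_singleton[OF tvs_bounded_gauss[OF w] delta_in_dual_S[OF w, of 0 0]])
       (simp add: delta_def gauss_in_S_set[OF w])
  define V where "V = {R \<in> topspace (prod_topology (strong_dual ?X) (strong_dual ?Y)).
    (\<lambda>(T, S). convolution \<omega> T S) R \<in> W}"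
  have V: "openin (prod_topology (strong_dual ?X) (strong_dual ?Y)) V"
    unfolding V_def using cont W by (rule openin_continuous_map_preimage)
  have 0: "?T 0 0 \<in> dual_space ?X" "?S 0 0 \<in> dual_space ?Y"
    by (rule delta_in_dual_OC[OF w], rule delta_in_dual_S[OF w])
  \<comment> \<open>Membership in the dual is read off from the assumed continuity, which includes
    mapping into the \<open>topspace\<close>.\<close>
  then have "convolution \<omega> (?T 0 0) (?S 0 0) \<in> dual_space ?Y"
    using continuous_map_image_subset_topspace[OF cont] by (auto simp: image_subset_iff)
  then have in_V: "(?T 0 0, ?S 0 0) \<in> V"
    using 0 by (simp add: V_def W_def convolution_delta[OF w])
  obtain U1 U2 where U: "openin (strong_dual ?X) U1" "openin (strong_dual ?Y) U2"
    "?T 0 0 \<in> U1" "?S 0 0 \<in> U2" "U1 \<times> U2 \<subseteq> V"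
    using V[unfolded openin_prod_topology_alt, rule_format, OF in_V] by blast
  obtain \<B>1 \<delta>1 where 1: "finite \<B>1" "\<And>B. B \<in> \<B>1 \<Longrightarrow> tvs_bounded ?X B" "\<delta>1 > 0"
    "\<And>T. T \<in> dual_space ?X \<Longrightarrow> (\<And>B f. B \<in> \<B>1 \<Longrightarrow> f \<in> B \<Longrightarrow> norm (T f) < \<delta>1) \<Longrightarrow> T \<in> U1"
    by (rule strong_dual_nhd[OF U(1,3)]) (simp add: delta_def, blast)
  obtain \<B>2 \<delta>2 where 2: "finite \<B>2" "\<And>B. B \<in> \<B>2 \<Longrightarrow> tvs_bounded ?Y B" "\<delta>2 > 0"
    "\<And>T. T \<in> dual_space ?Y \<Longrightarrow> (\<And>B f. B \<in> \<B>2 \<Longrightarrow> f \<in> B \<Longrightarrow> norm (T f) < \<delta>2) \<Longrightarrow> T \<in> U2"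
    by (rule strong_dual_nhd[OF U(2,4)]) (simp add: delta_def, blast)
  have "\<exists>n. \<forall>B\<in>\<B>1. \<forall>g\<in>B. \<forall>x. norm (g x) \<le> real n * exp (real n * \<omega> (norm x))"
  proof (rule uniform_index_finite[OF 1(1)])
    fix B assume "B \<in> \<B>1"
    then obtain n :: nat where n: "\<And>g x. g \<in> B \<Longrightarrow> norm (g x) \<le> real n * exp (real n * \<omega> (norm x))"
      using tvs_bounded_OC[OF w 1(2)] by blast
    have "norm (g x) \<le> real m * exp (real m * \<omega> (norm x))" if "g \<in> B" "m \<ge> n" for g x m
    proof -
      have "real n * exp (real n * \<omega> (norm x)) \<le> real m * exp (real m * \<omega> (norm x))"
        using that(2) weight_norm_nonneg[OF w, of x] by (intro mult_mono) (auto intro: mult_right_mono)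
      then show ?thesis using n[OF that(1), of x] by linarith
    qed
    then show "\<exists>n. \<forall>m\<ge>n. \<forall>g\<in>B. \<forall>x. norm (g x) \<le> real m * exp (real m * \<omega> (norm x))" by blast
  qed
  then obtain n where n: "\<And>B g x. B \<in> \<B>1 \<Longrightarrow> g \<in> B \<Longrightarrow> norm (g x) \<le> real n * exp (real n * \<omega> (norm x))"
    by blast
  \<comment> \<open>The exponent \<open>n + 1\<close> exceeds by one the growth index found on the
    other side; this surplus leaves an uncancelled \<open>exp \<omega>\<close>.\<close>
  have "\<exists>C::nat. \<forall>B\<in>\<B>2. \<forall>g\<in>B. \<forall>x. exp (real (n + 1) * \<omega> (norm x)) * norm (g x) \<le> real C"
  proof (rule uniform_index_finite[OF 2(1)])
    fix B assume B: "B \<in> \<B>2"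
    obtain C where C: "\<And>g x. g \<in> B \<Longrightarrow> exp (real (n + 1) * \<omega> (norm x)) * norm (g x) \<le> C"
      by (rule tvs_bounded_S[OF w 2(2)[OF B], of "n + 1"]) (simp, blast)
    obtain k :: nat where "C \<le> real k" using real_arch_simple by blast
    then have "\<forall>m\<ge>k. \<forall>g\<in>B. \<forall>x. exp (real (n + 1) * \<omega> (norm x)) * norm (g x) \<le> real m"
      using C by (meson of_nat_mono order_trans)
    then show "\<exists>k. \<forall>m\<ge>k. \<forall>g\<in>B. \<forall>x. exp (real (n + 1) * \<omega> (norm x)) * norm (g x) \<le> real m" ..
  qed
  then obtain C :: nat where C: "\<And>B g x. B \<in> \<B>2 \<Longrightarrow> g \<in> B \<Longrightarrow> exp (real (n + 1) * \<omega> (norm x)) * norm (g x) \<le> real C"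
    by blast
  \<comment> \<open>Adding 1 in the denominators allows \<open>n = 0\<close> or \<open>C = 0\<close>
    and makes both estimates strict.\<close>
  define t where "t = \<delta>1 / (real n + 1)"
  define s where "s = \<delta>2 / (real C + 1)"
  have t: "t > 0" "t * real n < \<delta>1" and s: "s > 0" "s * real C < \<delta>2"
    using 1(3) 2(3) by (auto simp: t_def s_def field_simps)
  have small: "s * t * exp (\<omega> (norm z)) < 1" for z :: "real^'n"
  proof -
    let ?e = "\<omega> (norm z)"
    let ?a = "complex_of_real (t * exp (- (real n * ?e)))"
    let ?b = "complex_of_real (s * exp (real (n + 1) * ?e))"
    have "?T z ?a \<in> U1"
    proof (rule 1(4)[OF delta_in_dual_OC[OF w]])
      fix B g assume B: "B \<in> \<B>1" "g \<in> B"
      then have "g \<in> topspace ?X" using 1(2) unfolding tvs_bounded_def by blast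
      then have "norm (?T z ?a g) = t * exp (- (real n * ?e)) * norm (g z)"
        using t by (simp add: delta_def norm_mult)
      also have "\<dots> \<le> t * exp (- (real n * ?e)) * (real n * exp (real n * ?e))"
        using n[OF B] t by (intro mult_left_mono) auto
      also have "\<dots> = t * real n" by (simp add: exp_minus field_simps)
      finally show "norm (?T z ?a g) < \<delta>1" using t by simp
    qed
    \<comment> \<open>The translated Gaussian has its peak value 1 at \<open>- z\<close>, while the
      radial weight is the same there as at \<open>z\<close>.\<close>
    moreover have "?S (- z) ?b \<in> U2"
    proof (rule 2(4)[OF delta_in_dual_S[OF w]])
      fix B g assume B: "B \<in> \<B>2" "g \<in> B"
      then have "g \<in> S_set \<omega>" using 2(2) unfolding tvs_bounded_def by auto
      then have "norm (?S (- z) ?b g) = s * (exp (real (n + 1) * \<omega> (norm (- z))) * norm (g (- z)))"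
        using s by (simp add: delta_def norm_mult)
      also have "\<dots> \<le> s * real C"
        using C[OF B, of "- z"] s by (intro mult_left_mono) auto
      finally show "norm (?S (- z) ?b g) < \<delta>2" using s by simp
    qed
    ultimately have "convolution \<omega> (?T z ?a) (?S (- z) ?b) \<in> W"
      using U(5) unfolding V_def by auto
    then have "norm (?b * (?a * gauss z (- z))) < 1"
      by (simp add: W_def convolution_delta[OF w])
    moreover have "gauss z (- z) = 1"
      using gauss_translate[of 0 "- z" z] by (simp add: gauss_0_0)
    moreover have "exp (real (n + 1) * ?e) * exp (- (real n * ?e)) = exp ?e"
      by (simp add: algebra_simps flip: exp_add)
    ultimately show ?thesis using s t by (simp add: norm_mult mult_ac)
  qed
  obtain r where r: "r \<ge> 0" "\<omega> r \<ge> 1 / (s * t)" using weight_unbounded[OF w] by blast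
  obtain z :: "real^'n" where z: "norm z = r" using vector_choose_size[OF r(1)] by blast
  \<comment> \<open>As \<open>exp y \<ge> 1 + y\<close>, unboundedness of \<omega> itself suffices
    to violate \<open>small\<close>.\<close>
  have "1 / (s * t) < exp (\<omega> r)" using r(2) exp_ge_add_one_self[of "\<omega> r"] by linarith
  then show False using small[of z] s t z by (simp add: field_simps)
qed

end
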